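(* Let $l\ge 1$ and let $\mathcal{P}=\{P_0,\dots,P_{l-1}\}$ be a partition of $\omega$ into $l$ infinite sets such that $\min P_i<\min P_j$ whenever $i<j$. Let $\mathcal{E}^{\mathcal{P}'}_\infty$ be the set of all equivalence relations $E$ on $\omega$ such that (a) $E$ has infinitely many equivalence classes, (b) for every $k<\omega$, $p_k(E)\in P_n$ where $n<l$ and $n\equiv k\pmod l$, and (c) for every $n<l$ and every equivalence class $X$ of $E$ with $\min X\in P_n$, we have $X\subseteq\bigcup_{n\le m<l}P_m$. Then $(\mathcal{E}^{\mathcal{P}'}_\infty,\le,r)$ is a topological Ramsey space.
   Context: For an equivalence relation $E$ on $\omega$, $(p_k(E))_{k<\omega}$ is the increasing enumeration of the set of minimal elements of its equivalence classes. For equivalence relations $E,F$ on the same set, $E\le F$ means every $E$-class is a union of $F$-classes. For a set $\mathcal{R}$ of equivalence relations on $\omega$ with infinitely many classes: $r_n(E)=E\restriction\{0,1,\dots,p_n(E)-1\}$; $\mathcal{AR}$ is the set of all $r_n(E)$ with $E\in\mathcal{R}$; for $a\in\mathcal{AR}$, $B\in\mathcal{R}$, $[a,B]=\{A\in\mathcal{R}: A\le B,\ r_n(A)=a\text{ for some }n\}$. The Ellentuck topology on $\mathcal{R}$ is generated by the sets $[a,B]$. $\mathcal{X}\subseteq\mathcal{R}$ has the property of Baire if $\mathcal{X}=\mathcal{O}\triangle M$ with $\mathcal{O}$ Ellentuck open and $M$ Ellentuck meagre; $\mathcal{X}$ is Ramsey if for every non-empty $[a,B]$ there is $A\in[a,B]$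 with $[a,A]\subseteq\mathcal{X}$ or $[a,A]\cap\mathcal{X}=\emptyset$, and Ramsey null if the second alternative can always be achieved. $(\mathcal{R},\le,r)$ is a topological Ramsey space if a subset of $\mathcal{R}$ has the property of Baire iff it is Ramsey, and is Ellentuck meagre iff it is Ramsey null. *)

theory Defs
  imports "HOL-Analysis.Analysis"
begin

definition nowhere_dense_in :: "'a topology \<Rightarrow> 'a set \<Rightarrow> bool" where
  "nowhere_dense_in T S \<longleftrightarrow> S \<subseteq> topspace T \<and> T interior_of (T closure_of S) = {}"

definition meagre_in :: "'a topology \<Rightarrow> 'a set \<Rightarrow> bool" where
  "meagre_in T M \<longleftrightarrow>
     (\<exists>N :: nat \<Rightarrow> 'a set. (\<forall>i. nowhere_dense_in T (N i)) \<and> M = (\<Union>i. N i))"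

definition has_baire_property_in :: "'a topology \<Rightarrow> 'a set \<Rightarrow> bool" where
  "has_baire_property_in T X \<longleftrightarrow>
     (\<exists>U M. openin T U \<and> meagre_in T M \<and> X = sym_diff U M)"

definition class_minima :: "nat rel \<Rightarrow> nat set" where
  "class_minima E = {LEAST x. x \<in> X | X. X \<in> UNIV // E}"

text \<open>Only meaningful if \<open>E\<close> has infinitely many classes.\<close>

definition class_min :: "nat \<Rightarrow> nat rel \<Rightarrow> nat" where
  "class_min k E = enumerate (class_minima E) k"

definition coarser :: "nat rel \<Rightarrow> nat rel \<Rightarrow> bool" where
  "coarser E F \<longleftrightarrow> (\<forall>X \<in> UNIV // E. \<exists>\<C> \<subseteq> UNIV // F. X = \<Union>\<C>)"

text \<open>The restriction of a reflexive relation determines the initial segment it lives on,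
  so the domain need not be recorded.\<close>

definition approx :: "nat \<Rightarrow> nat rel \<Rightarrow> nat rel" where
  "approx n E = E \<inter> ({..<class_min n E} \<times> {..<class_min n E})"

text \<open>Throughout, \<open>R\<close> is meant to be a set of equivalence relations on the natural numbers
  that have infinitely many classes.\<close>

definition approximations :: "nat rel set \<Rightarrow> nat rel set" where
  "approximations R = {approx n E | n E. E \<in> R}"

definition basic_set :: "nat rel set \<Rightarrow> nat rel \<Rightarrow> nat rel \<Rightarrow> nat rel set" where
  "basic_set R a B = {A \<in> R. coarser A B \<and> (\<exists>n. approx n A = a)}"

text \<open>The point set of this topology is \<open>R\<close>, since \<open>B\<close> lies in \<open>basic_set R (approx 0 B) B\<close>.\<close>

definition ellentuck_topology :: "nat rel set \<Rightarrow> nat rel topology" where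
  "ellentuck_topology R =
     topology_generated_by {basic_set R a B | a B. a \<in> approximations R \<and> B \<in> R}"

definition ramsey :: "nat rel set \<Rightarrow> nat rel set \<Rightarrow> bool" where
  "ramsey R X \<longleftrightarrow>
     (\<forall>a \<in> approximations R. \<forall>B \<in> R. basic_set R a B \<noteq> {} \<longrightarrow>
        (\<exists>A \<in> basic_set R a B. basic_set R a A \<subseteq> X \<or> basic_set R a A \<inter> X = {}))"

definition ramsey_null :: "nat rel set \<Rightarrow> nat rel set \<Rightarrow> bool" where
  "ramsey_null R X \<longleftrightarrow>
     (\<forall>a \<in> approximations R. \<forall>B \<in> R. basic_set R a B \<noteq> {} \<longrightarrow>
        (\<exists>A \<in> basic_set R a B. basic_set R a A \<inter> X = {}))"

definition topological_ramsey_space :: "nat rel set \<Rightarrow> bool" where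
  "topological_ramsey_space R \<longleftrightarrow>
     (\<forall>X \<subseteq> R. (has_baire_property_in (ellentuck_topology R) X \<longleftrightarrow> ramsey R X) \<and>
               (meagre_in (ellentuck_topology R) X \<longleftrightarrow> ramsey_null R X))"

definition E_inf :: "nat \<Rightarrow> (nat \<Rightarrow> nat set) \<Rightarrow> nat rel set" where
  "E_inf l P =
     {E. equiv UNIV E \<and> infinite (UNIV // E) \<and>
         (\<forall>k. class_min k E \<in> P (k mod l)) \<and>
         (\<forall>n<l. \<forall>X \<in> UNIV // E. (LEAST x. x \<in> X) \<in> P n \<longrightarrow> X \<subseteq> (\<Union>m\<in>{n..<l}. P m))}"

end

theory Submission
  imports Defs "HOL-Number_Theory.Cong"
begin

text \<open>An equivalence relation on the natural numbers is the fibre relation of the map sending each point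
  to the minimum of its class; coarsening becomes absorption \<open>f (g x) = f x\<close> under composition. With
  this dictionary amalgamation and fusion are explicit formulas. The pigeonhole principle for one-step
  extensions is the Carlson--Simpson theorem for left-variable words: to respect the partition, the classes
  are read in blocks of \<open>l\<close> consecutive ones, and a letter lists, for each position in a block,
  an older class that may legally absorb the class at that position. The Carlson--Simpson theorem is
  obtained from idempotents in the Ellis semigroup of the action of words on colourings. Combinatorial
  forcing and fusion then give the Ramsey property of Ellentuck open sets.\<close>

section \<open>Compact right topological semigroups\<close>

text \<open>Condition (b) is the obstacle: for \<open>l > 1\<close>, absorbing a single class shifts
  the index of every later minimum by one and makes it violate (b). Hence classes survive or are
  absorbed in whole blocks of \<open>l\<close>, which keeps all indices unchanged modulo
  \<open>l\<close>. A repeated variable sends each position of its block to the same position of the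
  block that opened it, so the parts agree and (c) holds. The targets allowed by (c) depend only on
  the position in a block, so one finite alphabet serves all blocks. Comparing parts again, the next
  minimum of any extension must open a block; what precedes it is then a complete word, cut just
  before the first occurrence of a variable. This is why left-variable words are needed: the colour
  has to be controlled exactly at such cuts. The Ellis semigroup takes the place of ultrafilters on
  words and needs only product topologies over the two-point space. Two colours suffice, since the
  pigeonhole principle concerns membership in one set \<open>\<O>\<close>.\<close>

lemma exists_minimal_closed_subset:
  fixes T :: "'a::topological_space set"
  assumes "compact T" "closed T" "T \<noteq> {}" "Q T"
    and Inter: "\<And>\<C>. \<C> \<noteq> {} \<Longrightarrow> \<forall>X\<in>\<C>. Q X \<Longrightarrow> Q (\<Inter>\<C>)"
  shows "\<exists>M. closed M \<and> M \<noteq> {} \<and> M \<subseteq> T \<and> Q M \<and>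
    (\<forall>X. closed X \<longrightarrow> X \<noteq> {} \<longrightarrow> X \<subseteq> M \<longrightarrow> Q X \<longrightarrow> X = M)"
proof -
  define \<Phi> where "\<Phi> X \<longleftrightarrow> closed X \<and> X \<noteq> {} \<and> X \<subseteq> T \<and> Q X" for X
  \<comment> \<open>Zorn's lemma provides maximal elements, so it is applied to complements; by
    compactness the intersection of a chain is not empty. \<open>Q\<close> is kept abstract because
    both subsemigroups and left ideals are needed later.\<close>
  define \<A> where "\<A> = {- X |X. \<Phi> X}"
  have "\<exists>U\<in>\<A>. \<forall>X\<in>\<C>. X \<subseteq> U" if C: "subset.chain \<A> \<C>" for \<C>
  proof (cases "\<C> = {}")
    case True
    then show ?thesis using assms by (auto simp: \<A>_def \<Phi>_def)
  next
    case False
    define \<D> where "\<D> = uminus ` \<C>"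
    have phi: "\<forall>X\<in>\<D>. \<Phi> X"
      using C by (force simp: \<D>_def \<A>_def subset_chain_def)
    have chain: "X \<subseteq> Y \<or> Y \<subseteq> X" if "X \<in> \<D>" "Y \<in> \<D>" for X Y
      using C that unfolding \<D>_def subset_chain_def by auto
    have fin: "\<Inter>\<F> \<in> \<D>" if "finite \<F>" "\<F> \<noteq> {}" "\<F> \<subseteq> \<D>" for \<F>
      using that
    proof (induction rule: finite_ne_induct)
      case (insert X \<F>)
      then show ?case using chain[of X "\<Inter>\<F>"] by (auto simp: Int_absorb1 Int_absorb2)
    qed auto
    have "T \<inter> \<Inter>\<D> \<noteq> {}"
    proof (rule compact_imp_fip[OF \<open>compact T\<close>])
      fix \<F> assume "finite \<F>" "\<F> \<subseteq> \<D>"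
      then show "T \<inter> \<Inter>\<F> \<noteq> {}"
        using fin[of \<F>] phi \<open>T \<noteq> {}\<close> by (cases "\<F> = {}") (auto simp: \<Phi>_def Int_absorb1)
    qed (use phi in \<open>auto simp: \<Phi>_def\<close>)
    moreover have "\<D> \<noteq> {}" using False by (simp add: \<D>_def)
    ultimately have "\<Phi> (\<Inter>\<D>)"
      using phi Inter[of \<D>] unfolding \<Phi>_def by (auto intro!: closed_Inter)
    then have "- \<Inter>\<D> \<in> \<A>" by (auto simp: \<A>_def)
    moreover have "\<forall>X\<in>\<C>. X \<subseteq> - \<Inter>\<D>" by (auto simp: \<D>_def)
    ultimately show ?thesis by blast
  qed
  from subset_Zorn[OF this] obtain N where N: "N \<in> \<A>" "\<And>X. X \<in> \<A> \<Longrightarrow> N \<subseteq> X \<Longrightarrow> X = N"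
    by blast
  then obtain M where M: "N = - M" "\<Phi> M" by (auto simp: \<A>_def)
  show ?thesis
  proof (intro exI[of _ M] conjI allI impI)
    fix X assume "closed X" "X \<noteq> {}" "X \<subseteq> M" "Q X"
    then have "- X \<in> \<A>" using M by (auto simp: \<A>_def \<Phi>_def)
    then have "- X = N" using N(2)[of "- X"] M \<open>X \<subseteq> M\<close> by auto
    then show "X = M" using M by auto
  qed (use M in \<open>auto simp: \<Phi>_def\<close>)
qed

text \<open>Continuity in the left factor alone is what composition of maps has in the topology of
  pointwise convergence. Separation is a hypothesis on \<open>euclidean\<close> because the carriers
  are iterated function spaces, where it comes from product topologies.\<close>

locale compact_right_topological_semigroup =
  fixes T :: "'a::topological_space set" and mult :: "'a \<Rightarrow> 'a \<Rightarrow> 'a" (infixl "\<star>" 70)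
  assumes hausdorff: "Hausdorff_space (euclidean :: 'a topology)"
    and compact: "compact T"
    and nonempty: "T \<noteq> {}"
    and mult_closed: "a \<in> T \<Longrightarrow> b \<in> T \<Longrightarrow> a \<star> b \<in> T"
    and assoc: "(a \<star> b) \<star> c = a \<star> (b \<star> c)"
    and cont: "b \<in> T \<Longrightarrow> continuous_on T (\<lambda>a. a \<star> b)"
begin

lemma compact_closed: "compact S \<Longrightarrow> closed (S :: 'a set)"
  using compactin_imp_closedin[OF hausdorff, of S]
  by (simp only: closed_closedin compactin_euclidean_iff)

lemma closed_carrier: "closed T"
  using compact compact_closed by blast

lemma compact_subset_carrier: "closed S \<Longrightarrow> S \<subseteq> T \<Longrightarrow> compact S"
  using compact_Int_closed[OF compact, of S] by (simp add: Int_absorb1)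

lemma closed_right_translate:
  assumes "closed S" "S \<subseteq> T" "b \<in> T"
  shows "closed ((\<lambda>a. a \<star> b) ` S)"
  by (rule compact_closed[OF compact_continuous_image[OF continuous_on_subset[OF cont[OF assms(3)] assms(2)]
        compact_subset_carrier[OF assms(1,2)]]])

text \<open>The Ellis-Numakura lemma: every element \<open>x\<close> of a minimal closed
  subsemigroup \<open>M\<close> is idempotent, because both \<open>M \<star> x\<close> and the
  solution set of \<open>a \<star> x = x\<close> in \<open>M\<close> are closed subsemigroups, hence
  all of \<open>M\<close>.\<close>

lemma exists_idempotent:
  assumes "closed S" "S \<noteq> {}" "S \<subseteq> T" and S: "\<And>a b. a \<in> S \<Longrightarrow> b \<in> S \<Longrightarrow> a \<star> b \<in> S"
  obtains e where "e \<in> S" "e \<star> e = e"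
proof -
  have "compact S" using compact_subset_carrier[OF assms(1,3)] .
  have "\<exists>M. closed M \<and> M \<noteq> {} \<and> M \<subseteq> S \<and> (\<forall>a\<in>M. \<forall>b\<in>M. a \<star> b \<in> M) \<and>
      (\<forall>X. closed X \<longrightarrow> X \<noteq> {} \<longrightarrow> X \<subseteq> M \<longrightarrow> (\<forall>a\<in>X. \<forall>b\<in>X. a \<star> b \<in> X) \<longrightarrow> X = M)"
    by (rule exists_minimal_closed_subset) (use assms \<open>compact S\<close> in auto)
  then obtain M where M: "closed M" "M \<noteq> {}" "M \<subseteq> S"
      and sub': "\<forall>a\<in>M. \<forall>b\<in>M. a \<star> b \<in> M"
      and min': "\<forall>X. closed X \<longrightarrow> X \<noteq> {} \<longrightarrow> X \<subseteq> M \<longrightarrow> (\<forall>a\<in>X. \<forall>b\<in>X. a \<star> b \<in> X) \<longrightarrow> X = M"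
    by (elim exE conjE) (rule that)
  note sub = sub'[rule_format] and min = min'[rule_format]
  obtain x where x: "x \<in> M" using M by blast
  have xT: "x \<in> T" and MT: "M \<subseteq> T" using x M assms by auto
  have "(\<lambda>a. a \<star> x) ` M = M"
  proof (rule min)
    show "a \<star> b \<in> (\<lambda>a. a \<star> x) ` M" if ab: "a \<in> (\<lambda>a. a \<star> x) ` M" "b \<in> (\<lambda>a. a \<star> x) ` M" for a b
    proof -
      obtain a' b' where "a' \<in> M" "b' \<in> M" and eq: "a = a' \<star> x" "b = b' \<star> x" using ab by blast
      then have "a' \<star> x \<star> b' \<in> M" using sub x by blast
      moreover have "a \<star> b = (a' \<star> x \<star> b') \<star> x" by (simp only: eq assoc)
      ultimately show ?thesis by blast
    qed
    show "closed ((\<lambda>a. a \<star> x) ` M)" by (rule closed_right_translate[OF M(1) MT xT])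
    show "(\<lambda>a. a \<star> x) ` M \<subseteq> M" using sub x by blast
  qed (use M in blast)
  with x have "x \<in> (\<lambda>a. a \<star> x) ` M" by simp
  then obtain a where a: "a \<in> M" "a \<star> x = x" by (elim imageE) simp
  \<comment> \<open>The previous equality makes this solution set nonempty; minimality now puts
    \<open>x\<close> itself into it.\<close>
  have "M \<inter> (\<lambda>a. a \<star> x) -` {x} = M"
  proof (rule min)
    have "closed {x}" by (rule compact_closed) simp
    then show "closed (M \<inter> (\<lambda>a. a \<star> x) -` {x})"
      by (intro continuous_closed_preimage continuous_on_subset[OF cont[OF xT] MT] M)
    show "a \<star> b \<in> M \<inter> (\<lambda>a. a \<star> x) -` {x}"
      if "a \<in> M \<inter> (\<lambda>a. a \<star> x) -` {x}" "b \<in> M \<inter> (\<lambda>a. a \<star> x) -` {x}" for a b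
      using that sub by (simp add: assoc)
  qed (use a in auto)
  then have "x \<star> x = x" using x by blast
  then show ?thesis using that x M by blast
qed

text \<open>Any idempotent \<open>p\<close> of a minimal closed left ideal \<open>L\<close> will do.
  An idempotent \<open>q\<close> below \<open>p\<close> lies in \<open>L\<close>, so
  \<open>L \<star> q = L\<close> and \<open>p = s \<star> q\<close> for some \<open>s\<close>; then
  \<open>p \<star> q = p\<close>.\<close>

lemma exists_minimal_idempotent:
  obtains p where "p \<in> T" "p \<star> p = p"
    "\<forall>q\<in>T. q \<star> q = q \<longrightarrow> q \<star> p = q \<longrightarrow> p \<star> q = q \<longrightarrow> q = p"
proof -
  have "\<exists>M. closed M \<and> M \<noteq> {} \<and> M \<subseteq> T \<and> (\<forall>a\<in>T. \<forall>b\<in>M. a \<star> b \<in> M) \<and>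
      (\<forall>X. closed X \<longrightarrow> X \<noteq> {} \<longrightarrow> X \<subseteq> M \<longrightarrow> (\<forall>a\<in>T. \<forall>b\<in>X. a \<star> b \<in> X) \<longrightarrow> X = M)"
    by (rule exists_minimal_closed_subset) (use compact closed_carrier nonempty mult_closed in auto)
  then obtain L where L: "closed L" "L \<noteq> {}" "L \<subseteq> T"
      and ideal': "\<forall>a\<in>T. \<forall>b\<in>L. a \<star> b \<in> L"
      and min': "\<forall>X. closed X \<longrightarrow> X \<noteq> {} \<longrightarrow> X \<subseteq> L \<longrightarrow> (\<forall>a\<in>T. \<forall>b\<in>X. a \<star> b \<in> X) \<longrightarrow> X = L"
    by (elim exE conjE) (rule that)
  note ideal = ideal'[rule_format] and min = min'[rule_format]
  obtain p where p: "p \<in> L" "p \<star> p = p"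
    using exists_idempotent[OF L] ideal L by blast
  show ?thesis
  proof (rule that[of p])
    show "\<forall>q\<in>T. q \<star> q = q \<longrightarrow> q \<star> p = q \<longrightarrow> p \<star> q = q \<longrightarrow> q = p"
    proof (intro ballI impI)
      fix q assume q: "q \<in> T" "q \<star> q = q" "q \<star> p = q" "p \<star> q = q"
      have qL: "q \<in> L" using ideal[OF q(1) p(1)] q by simp
      have "(\<lambda>a. a \<star> q) ` L = L"
      proof (rule min)
        show "a \<star> b \<in> (\<lambda>a. a \<star> q) ` L" if ab: "a \<in> T" "b \<in> (\<lambda>a. a \<star> q) ` L" for a b
        proof -
          obtain b' where "b' \<in> L" and b: "b = b' \<star> q" using ab by blast
          then have "a \<star> b' \<in> L" using ideal ab by blast
          moreover have "a \<star> b = (a \<star> b') \<star> q" by (simp only: b assoc)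
          ultimately show ?thesis by blast
        qed
        show "closed ((\<lambda>a. a \<star> q) ` L)" by (rule closed_right_translate[OF L(1,3) q(1)])
        show "(\<lambda>a. a \<star> q) ` L \<subseteq> L" using ideal qL L by blast
      qed (use L in blast)
      with p have "p \<in> (\<lambda>a. a \<star> q) ` L" by simp
      then obtain s where "p = s \<star> q" by blast
      then have "p \<star> q = p" using q by (simp add: assoc)
      then show "q = p" using q by simp
    qed
  qed (use p L in auto)
qed

text \<open>An idempotent \<open>e\<close> of the closed subsemigroup \<open>I \<star> p\<close> is
  fixed by \<open>p\<close> from the right only; \<open>p \<star> e\<close> is fixed from both
  sides, and \<open>e \<star> p = e\<close> keeps it idempotent.\<close>

lemma exists_idempotent_below_in_ideal:
  assumes "closed I" "I \<noteq> {}" "I \<subseteq> T"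
    and left: "\<And>a b. a \<in> T \<Longrightarrow> b \<in> I \<Longrightarrow> a \<star> b \<in> I"
    and right: "\<And>a b. a \<in> I \<Longrightarrow> b \<in> T \<Longrightarrow> a \<star> b \<in> I"
    and p: "p \<in> T" "p \<star> p = p"
  obtains q where "q \<in> I" "q \<star> q = q" "q \<star> p = q" "p \<star> q = q"
proof -
  obtain e where e: "e \<in> (\<lambda>a. a \<star> p) ` I" "e \<star> e = e"
  proof (rule exists_idempotent)
    show "a \<star> b \<in> (\<lambda>a. a \<star> p) ` I" if "a \<in> (\<lambda>a. a \<star> p) ` I" "b \<in> (\<lambda>a. a \<star> p) ` I" for a b
      using that assms right[of _ "p \<star> b"] by (auto simp: assoc[symmetric] subset_iff)
    show "(\<lambda>a. a \<star> p) ` I \<subseteq> T" using assms right by blast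
  qed (use assms right closed_right_translate in auto)
  have ep: "e \<star> p = e" using e p by (auto simp: assoc)
  have eI: "e \<in> I" using e right p by auto
  have "p \<star> e \<star> (p \<star> e) = p \<star> (e \<star> p) \<star> e" by (simp only: assoc)
  also have "\<dots> = p \<star> e" using ep e by (simp add: assoc)
  finally have "p \<star> e \<star> (p \<star> e) = p \<star> e" .
  moreover have "p \<star> (p \<star> e) = p \<star> e" using p by (simp add: assoc[symmetric])
  moreover have "p \<star> e \<star> p = p \<star> e" using ep by (simp add: assoc)
  ultimately show ?thesis using that left[OF p(1) eI] by blast
qed

end

section \<open>The Carlson--Simpson theorem\<close>

text \<open>The translate of a colouring by a suffix. Appending on the right makes
  \<open>act\<close> a homomorphism from concatenation to composition without reversing the
  order.\<close>

definition act :: "'a list \<Rightarrow> ('a list \<Rightarrow> bool) \<Rightarrow> 'a list \<Rightarrow> bool" where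
  "act y c = (\<lambda>w. c (w @ y))"

text \<open>A variable word is a list of options in which \<open>None\<close> is the
  variable.\<close>

definition subst :: "'a \<Rightarrow> 'a option list \<Rightarrow> 'a list" where
  "subst a = map (case_option a id)"

lemma subst_append [simp]: "subst a (x @ y) = subst a x @ subst a y"
  by (simp add: subst_def)

lemma act_append: "act (x @ y) = act x \<circ> act y"
  by (auto simp: act_def fun_eq_iff)

section \<open>Compactness, separation and closures in function spaces\<close>

lemma compact_UNIV_fun:
  assumes "compact (UNIV :: 'b::topological_space set)"
  shows "compact (UNIV :: ('a \<Rightarrow> 'b) set)"
proof -
  have "compact_space (euclidean :: 'b topology)"
    using assms by (simp add: compact_space_def)
  then have "compact_space (product_topology (\<lambda>i::'a. euclidean :: 'b topology) UNIV)"
    by (simp add: compact_space_product_topology)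
  then show ?thesis unfolding euclidean_product_topology by (simp add: compact_space_def)
qed

lemma Hausdorff_space_fun:
  assumes "Hausdorff_space (euclidean :: 'b::topological_space topology)"
  shows "Hausdorff_space (euclidean :: ('a \<Rightarrow> 'b) topology)"
  using assms Hausdorff_space_product_topology[of "\<lambda>i::'a. euclidean :: 'b topology" UNIV]
  by (simp add: euclidean_product_topology)

lemma Hausdorff_space_t2: "Hausdorff_space (euclidean :: 'a::t2_space topology)"
  unfolding Hausdorff_space_def disjnt_def
proof (intro allI impI)
  fix x y :: 'a assume "x \<in> topspace euclidean \<and> y \<in> topspace euclidean \<and> x \<noteq> y"
  then have "x \<noteq> y" by blast
  from hausdorff[OF this] show
    "\<exists>U V. openin euclidean U \<and> openin euclidean V \<and> x \<in> U \<and> y \<in> V \<and> U \<inter> V = {}"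
    by (simp only: open_openin[symmetric])
qed

lemma compact_bool: "compact (UNIV :: bool set)"
  by (simp add: finite_imp_compact)

lemma compact_closure:
  assumes "compact (UNIV :: 'b::topological_space set)"
  shows "compact (closure X :: 'b set)"
  using compact_Int_closed[OF assms closed_closure, of X] by simp

lemma continuous_act: "continuous_on UNIV (act y)"
  unfolding act_def by (intro continuous_on_coordinatewise_then_product) simp

text \<open>Left multiplication is continuous only for factors from \<open>A\<close> itself, so the
  order of the two limits matters: first in \<open>b\<close> with \<open>a\<close> in
  \<open>A\<close>, then in \<open>a\<close> with \<open>b\<close> fixed in the closure.\<close>

lemma closure_mult_subset:
  fixes mult :: "'b::topological_space \<Rightarrow> 'b \<Rightarrow> 'b"
  assumes left: "\<And>a. a \<in> A \<Longrightarrow> continuous_on UNIV (mult a)"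
    and right: "\<And>b. continuous_on UNIV (\<lambda>a. mult a b)"
    and sub: "\<And>a b. a \<in> A \<Longrightarrow> b \<in> B \<Longrightarrow> mult a b \<in> C"
    and "a \<in> closure A" "b \<in> closure B"
  shows "mult a b \<in> closure C"
proof -
  have 1: "mult a b \<in> closure C" if "a \<in> A" "b \<in> closure B" for a b
  proof -
    have "mult a ` closure B \<subseteq> closure C"
    proof (rule image_closure_subset)
      show "mult a ` B \<subseteq> closure C" using sub[OF that(1)] closure_subset[of C] by blast
    qed (use continuous_on_subset[OF left[OF that(1)] subset_UNIV] in auto)
    then show ?thesis using that by blast
  qed
  have "(\<lambda>a. mult a b) ` closure A \<subseteq> closure C"
  proof (rule image_closure_subset)
    show "(\<lambda>a. mult a b) ` A \<subseteq> closure C" using 1 assms(5) by blast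
  qed (use continuous_on_subset[OF right[of b] subset_UNIV] in auto)
  then show ?thesis using assms(4) by blast
qed

lemma continuous_on_eval2: "continuous_on UNIV (\<lambda>F :: 'a \<Rightarrow> 'b \<Rightarrow> 'c::topological_space. F x y)"
  by (rule continuous_on_product_then_coordinatewise[OF continuous_on_product_coordinates])

lemma continuous_on_eval3:
  "continuous_on UNIV (\<lambda>F :: 'a \<Rightarrow> 'b \<Rightarrow> 'c \<Rightarrow> 'd::topological_space. F x y z)"
  by (rule continuous_on_product_then_coordinatewise[OF continuous_on_eval2])

text \<open>The way back from limits to words: with discrete values, a limit coincides on finitely
  many arguments with an actual element of the set.\<close>

lemma closure_agrees_finite:
  fixes G :: "'a \<Rightarrow> 'b \<Rightarrow> 'c \<Rightarrow> 'd::discrete_topology"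
  assumes "G \<in> closure J" "finite N"
  obtains H where "H \<in> J" "\<forall>(x, y, z)\<in>N. H x y z = G x y z"
proof -
  define U where "U = (\<Inter>(x, y, z)\<in>N. (\<lambda>H :: 'a \<Rightarrow> 'b \<Rightarrow> 'c \<Rightarrow> 'd. H x y z) -` {G x y z})"
  have "open U"
    unfolding U_def using assms(2)
    by (intro open_INT) (auto intro!: open_vimage continuous_on_eval3 simp: open_discrete)
  moreover have "G \<in> U" by (auto simp: U_def)
  ultimately obtain H where "H \<in> J" "H \<in> U"
    using assms(1) by (meson closure_iff_nhds_not_empty disjoint_iff order_refl)
  then show ?thesis by (intro that[of H]) (auto simp: U_def)
qed

text \<open>In the Ellis semigroup \<open>E\<close> of the action on colourings take a minimal idempotent \<open>p\<close>.
  Among the limits of the tuples \<open>(y[a])\<^sub>a\<close>, \<open>y\<close> a variable word, there is an idempotent \<open>q\<close>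
  below the constant tuple \<open>p\<close>; each of its components is an idempotent of \<open>E\<close> below \<open>p\<close>, hence
  equals \<open>p\<close>.\<close>

lemma idempotent_limit_of_variable_words:
  fixes L :: "'a set"
  obtains p q where "p \<circ> p = p"
    "q \<in> closure ((\<lambda>y a. act (subst a y)) ` {y \<in> lists (insert None (Some ` L)). None \<in> set y})"
    "\<And>a. a \<in> L \<Longrightarrow> q a = p"
proof -
  let ?V = "lists (insert None (Some ` L))"
  let ?f = "\<lambda>(y :: 'a option list) a. act (subst a y)"
  let ?mult = "\<lambda>(F :: 'a \<Rightarrow> ('a list \<Rightarrow> bool) \<Rightarrow> 'a list \<Rightarrow> bool) (G :: 'a \<Rightarrow> ('a list \<Rightarrow> bool) \<Rightarrow> 'a list \<Rightarrow> bool) a. F a \<circ> G a"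
  define E where "E = closure (act ` lists L)"
  define T where "T = closure (?f ` ?V)"
  define I where "I = closure (?f ` {y \<in> ?V. None \<in> set y})"
  have cK: "compact (UNIV :: ('a list \<Rightarrow> bool) set)"
    and hK: "Hausdorff_space (euclidean :: ('a list \<Rightarrow> bool) topology)"
    by (rule compact_UNIV_fun compact_bool Hausdorff_space_fun Hausdorff_space_t2)+
  have cont2: "continuous_on UNIV (?mult F)" if "\<And>a. continuous_on UNIV (F a)"
    for F :: "'a \<Rightarrow> ('a list \<Rightarrow> bool) \<Rightarrow> 'a list \<Rightarrow> bool"
  proof (intro continuous_on_coordinatewise_then_product)
    fix a c w
    have 1: "continuous_on UNIV (\<lambda>c. F a c w)"
      by (rule continuous_on_product_then_coordinatewise[OF that])
    show "continuous_on UNIV (\<lambda>G. (F a \<circ> G a) c w)"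
      using continuous_on_compose2[OF 1 continuous_on_eval2[of a c]] by (simp add: o_def)
  qed
  have cont1: "continuous_on UNIV (\<lambda>g :: ('a list \<Rightarrow> bool) \<Rightarrow> 'a list \<Rightarrow> bool. f \<circ> g)" if "continuous_on UNIV f"
    for f :: "('a list \<Rightarrow> bool) \<Rightarrow> 'a list \<Rightarrow> bool"
  proof (intro continuous_on_coordinatewise_then_product)
    fix c w
    have 1: "continuous_on UNIV (\<lambda>c. f c w)"
      by (rule continuous_on_product_then_coordinatewise[OF that])
    have 2: "continuous_on UNIV (\<lambda>g :: ('a list \<Rightarrow> bool) \<Rightarrow> 'a list \<Rightarrow> bool. g c)" by simp
    show "continuous_on UNIV (\<lambda>g. (f \<circ> g) c w)"
      using continuous_on_compose2[OF 1 2] by (simp add: o_def)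
  qed
  have right1: "continuous_on UNIV (\<lambda>f. f \<circ> g)"
    for g :: "('a list \<Rightarrow> bool) \<Rightarrow> 'a list \<Rightarrow> bool"
    by (intro continuous_on_coordinatewise_then_product) (simp add: continuous_on_eval2)
  have right2: "continuous_on UNIV (\<lambda>F. ?mult F G)"
    for G :: "'a \<Rightarrow> ('a list \<Rightarrow> bool) \<Rightarrow> 'a list \<Rightarrow> bool"
    by (intro continuous_on_coordinatewise_then_product) (simp add: continuous_on_eval3)
  have mult_T: "?mult F G \<in> closure (?f ` C)"
    if "F \<in> closure (?f ` A)" "G \<in> closure (?f ` B)" "\<And>x y. x \<in> A \<Longrightarrow> y \<in> B \<Longrightarrow> x @ y \<in> C"
    for F G and A B C :: "'a option list set"
  proof (rule closure_mult_subset[where mult = ?mult, OF _ _ _ that(1,2)])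
    fix F' :: "'a \<Rightarrow> ('a list \<Rightarrow> bool) \<Rightarrow> 'a list \<Rightarrow> bool"
    assume "F' \<in> ?f ` A"
    then show "continuous_on UNIV (?mult F')"
      using continuous_act by (intro cont2) auto
  next
    fix F' G' assume "F' \<in> ?f ` A" "G' \<in> ?f ` B"
    then obtain x y where "x \<in> A" "y \<in> B" "F' = ?f x" "G' = ?f y" by blast
    then show "?mult F' G' \<in> ?f ` C"
      using that(3)[of x y] by (intro image_eqI[of _ _ "x @ y"]) (auto simp: act_append)
  next
    show "continuous_on UNIV (\<lambda>F. ?mult F G)" for G by (rule right2)
  qed
  interpret E: compact_right_topological_semigroup E "(\<circ>)"
  proof
    show "f \<circ> g \<in> E" if "f \<in> E" "g \<in> E" for f g
      unfolding E_def
    proof (rule closure_mult_subset[where mult = "(\<circ>)" and A = "act ` lists L" and B = "act ` lists L"])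
      fix f g assume "f \<in> act ` lists L" "g \<in> act ` lists L"
      then obtain x y where "x \<in> lists L" "y \<in> lists L" "f = act x" "g = act y" by blast
      then show "f \<circ> g \<in> act ` lists L"
        by (intro image_eqI[of _ _ "x @ y"]) (auto simp: act_append)
    next
      fix f :: "('a list \<Rightarrow> bool) \<Rightarrow> 'a list \<Rightarrow> bool" assume "f \<in> act ` lists L"
      then have "continuous_on UNIV f" using continuous_act by blast
      then show "continuous_on UNIV ((\<circ>) f :: (('a list \<Rightarrow> bool) \<Rightarrow> 'a list \<Rightarrow> bool) \<Rightarrow> _)"
        by (rule cont1)
    next
      show "f \<in> closure (act ` lists L)" "g \<in> closure (act ` lists L)" using that by (simp_all add: E_def)
    qed (rule right1)
    show "continuous_on E (\<lambda>f. f \<circ> g)" for g :: "('a list \<Rightarrow> bool) \<Rightarrow> 'a list \<Rightarrow> bool"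
      by (rule continuous_on_subset[OF right1 subset_UNIV])
    show "E \<noteq> {}" using closure_subset[of "act ` lists L"] by (auto simp: E_def)
    show "compact E" unfolding E_def by (intro compact_closure compact_UNIV_fun cK)
    show "Hausdorff_space (euclidean :: (('a list \<Rightarrow> bool) \<Rightarrow> 'a list \<Rightarrow> bool) topology)"
      by (intro Hausdorff_space_fun hK)
  qed (simp add: o_assoc)
  interpret T: compact_right_topological_semigroup T ?mult
  proof
    show "?mult F G \<in> T" if "F \<in> T" "G \<in> T" for F G
      unfolding T_def by (rule mult_T[of _ ?V _ ?V]) (use that in \<open>auto simp: T_def\<close>)
    show "continuous_on T (\<lambda>F. ?mult F G)" for G
      by (rule continuous_on_subset[OF right2 subset_UNIV])
    show "T \<noteq> {}" using closure_subset[of "?f ` ?V"] by (auto simp: T_def)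
    show "compact T" unfolding T_def by (intro compact_closure compact_UNIV_fun cK)
    show "Hausdorff_space (euclidean :: ('a \<Rightarrow> ('a list \<Rightarrow> bool) \<Rightarrow> 'a list \<Rightarrow> bool) topology)"
      by (intro Hausdorff_space_fun hK)
  qed (simp add: o_assoc)
  obtain p where p: "p \<in> E" "p \<circ> p = p"
      and min: "\<forall>q\<in>E. q \<circ> q = q \<longrightarrow> q \<circ> p = q \<longrightarrow> p \<circ> q = q \<longrightarrow> q = p"
    using E.exists_minimal_idempotent by blast
  have IT: "I \<subseteq> T" unfolding I_def T_def by (intro closure_mono) auto
  \<comment> \<open>Words without a variable are unchanged by every substitution, so they contribute
    constant tuples, and limits of constant tuples are constant.\<close>
  have diag: "(\<lambda>_ :: 'a. p) \<in> T"
  proof -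
    have "(\<lambda>f (_ :: 'a). f) ` E \<subseteq> T"
      unfolding E_def
    proof (rule image_closure_subset)
      show "(\<lambda>f (_ :: 'a). f) ` act ` lists L \<subseteq> T"
      proof
        fix F assume "F \<in> (\<lambda>f (_ :: 'a). f) ` act ` lists L"
        then obtain x where x: "x \<in> lists L" "F = (\<lambda>_. act x)" by blast
        then have "?f (map Some x) \<in> ?f ` ?V" by (intro imageI) auto
        moreover have "?f (map Some x) = F"
          by (simp add: x subst_def o_def)
        ultimately have "F \<in> ?f ` ?V" by simp
        then show "F \<in> T" unfolding T_def by (rule subsetD[OF closure_subset])
      qed
      show "continuous_on (closure (act ` lists L)) (\<lambda>f (_ :: 'a). f)"
        by (intro continuous_on_coordinatewise_then_product)
          (rule continuous_on_subset[OF continuous_on_eval2 subset_UNIV])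
    qed (simp add: T_def)
    then show ?thesis using p by blast
  qed
  \<comment> \<open>Limits of words that do contain the variable form a two-sided ideal, since
    concatenation preserves an occurrence of it.\<close>
  obtain q where q: "q \<in> I" "?mult q q = q" "?mult q (\<lambda>_. p) = q" "?mult (\<lambda>_. p) q = q"
  proof (rule T.exists_idempotent_below_in_ideal[OF _ _ IT _ _ diag])
    have "?f [None] \<in> ?f ` {y \<in> ?V. None \<in> set y}" by (intro imageI) auto
    then show "I \<noteq> {}" unfolding I_def using closure_subset by blast
    show "?mult F G \<in> I" if "F \<in> T" "G \<in> I" for F G
      unfolding I_def by (rule mult_T[OF that[unfolded T_def I_def]]) auto
    show "?mult F G \<in> I" if "F \<in> I" "G \<in> T" for F G
      unfolding I_def by (rule mult_T[OF that[unfolded T_def I_def]]) auto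
  qed (use p in \<open>auto simp: I_def\<close>)
  show ?thesis
  proof (rule that[OF p(2) q(1)[unfolded I_def]])
    fix a assume a: "a \<in> L"
    have "(\<lambda>F. F a) ` T \<subseteq> E"
      unfolding T_def
    proof (rule image_closure_subset)
      show "(\<lambda>F. F a) ` ?f ` ?V \<subseteq> E"
      proof
        fix F assume "F \<in> (\<lambda>F. F a) ` ?f ` ?V"
        then obtain y where y: "y \<in> ?V" "F = act (subst a y)" by blast
        then have "subst a y \<in> lists L" using a by (fastforce simp: subst_def split: option.splits)
        then have "F \<in> act ` lists L" using y by blast
        then show "F \<in> E" unfolding E_def by (rule subsetD[OF closure_subset])
      qed
    qed (use continuous_on_subset[OF continuous_on_product_coordinates subset_UNIV] in \<open>auto simp: E_def\<close>)
    then have "q a \<in> E" using q(1) IT by blast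
    moreover have "q a \<circ> q a = q a" "q a \<circ> p = q a" "p \<circ> q a = q a"
      using q(2-4) by (simp_all add: fun_eq_iff)
    ultimately show "q a = p" using min by blast
  qed
qed

text \<open>The extra coordinate \<open>None\<close> records the constant prefix of a variable word, whose limit
  \<open>c1\<close> turns arbitrary variable words into left-variable ones.\<close>

lemma approximately_invariant_colourings:
  fixes L :: "'a set" and c :: "'a list \<Rightarrow> bool"
  assumes "finite L"
  obtains c1 c2 :: "'a list \<Rightarrow> bool" where
    "\<And>F. finite F \<Longrightarrow> \<exists>s\<in>lists L. \<exists>t\<in>lists (insert None (Some ` L)). \<forall>w\<in>F.
       c (w @ s) = c1 w \<and>
       (\<forall>a\<in>L. c1 (w @ s @ a # subst a t) = c2 w \<and> c2 (w @ s @ a # subst a t) = c2 w)"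
proof -
  let ?V = "{y \<in> lists (insert None (Some ` L)). None \<in> set y}"
  let ?f = "\<lambda>y a. act (subst a y)"
  let ?pre = "\<lambda>y. map the (takeWhile (\<lambda>z. z \<noteq> None) y)"
  let ?g = "\<lambda>y. case_option (act (?pre y)) (?f y)"
  obtain p q where p: "p \<circ> p = p" and q: "q \<in> closure (?f ` ?V)" "\<And>a. a \<in> L \<Longrightarrow> q a = p"
    using idempotent_limit_of_variable_words[of L] by blast
  \<comment> \<open>The prefix coordinate is added without losing \<open>q\<close>: forgetting it
    maps the compact closure of the extended tuples onto a closed set, which must contain the
    closure of the old tuples.\<close>
  have "q \<in> (\<lambda>G a. G (Some a)) ` closure (?g ` ?V)"
  proof -
    have "closure (?f ` ?V) \<subseteq> (\<lambda>G a. G (Some a)) ` closure (?g ` ?V)"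
    proof (rule closure_minimal)
      show "?f ` ?V \<subseteq> (\<lambda>G a. G (Some a)) ` closure (?g ` ?V)"
      proof
        fix F assume "F \<in> ?f ` ?V"
        then obtain y where "y \<in> ?V" "F = ?f y" by blast
        then show "F \<in> (\<lambda>G a. G (Some a)) ` closure (?g ` ?V)"
          using closure_subset[of "?g ` ?V"] by (intro image_eqI[of _ _ "?g y"]) auto
      qed
      have "compact (closure (?g ` ?V))"
        by (intro compact_closure compact_UNIV_fun compact_bool)
      moreover have "continuous_on UNIV (\<lambda>(G :: 'a option \<Rightarrow> ('a list \<Rightarrow> bool) \<Rightarrow> 'a list \<Rightarrow> bool) a. G (Some a))"
        by (intro continuous_on_coordinatewise_then_product) (rule continuous_on_eval3)
      ultimately have "compact ((\<lambda>G a. G (Some a)) ` closure (?g ` ?V))"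
        by (meson compact_continuous_image continuous_on_subset subset_UNIV)
      moreover have "Hausdorff_space (euclidean :: ('a \<Rightarrow> ('a list \<Rightarrow> bool) \<Rightarrow> 'a list \<Rightarrow> bool) topology)"
        by (intro Hausdorff_space_fun Hausdorff_space_t2)
      ultimately show "closed ((\<lambda>G a. G (Some a)) ` closure (?g ` ?V))"
        by (simp only: closed_closedin compactin_euclidean_iff[symmetric] compactin_imp_closedin)
    qed
    then show ?thesis using q by blast
  qed
  then obtain G where G: "G \<in> closure (?g ` ?V)" and Gq: "\<And>a. G (Some a) = q a" by auto
  define c1 where "c1 = G None c"
  \<comment> \<open>Since every \<open>q a\<close> equals \<open>p\<close>, the colour after the
    substitution of any letter tends to the same value; idempotence of \<open>p\<close> makes
    \<open>c2\<close> invariant.\<close>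
  define c2 where "c2 = p c1"
  have pc2: "p c2 = c2" using p unfolding c2_def by (metis comp_apply)
  show ?thesis
  proof (rule that[of c1 c2])
    fix F :: "'a list set" assume "finite F"
    \<comment> \<open>The arguments to be matched: the prefix limit at \<open>c\<close>, and the
      substitution limits at \<open>c1\<close> and \<open>c2\<close>.\<close>
    define N where "N = {None} \<times> {c} \<times> F \<union> Some ` L \<times> {c1, c2} \<times> F"
    have "finite N" using assms \<open>finite F\<close> by (simp add: N_def)
    then obtain H where H: "H \<in> ?g ` ?V" "\<forall>(x, y, z)\<in>N. H x y z = G x y z"
      by (rule closure_agrees_finite[OF G])
    then obtain y where y: "y \<in> ?V" "H = ?g y" by blast
    from y have "None \<in> set y" by blast
    then obtain u t where ut: "y = u @ None # t" "None \<notin> set u"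
      by (meson split_list_first)
    define s where "s = map the u"
    have us: "u = map Some s" unfolding s_def map_map
      by (rule sym, rule map_idI) (use ut(2) in \<open>metis comp_apply option.collapse\<close>)
    have pre: "?pre y = s" unfolding ut us by (simp add: takeWhile_append o_def)
    have sub: "subst a y = s @ a # subst a t" for a
      unfolding ut us by (simp add: subst_def o_def)
    have "s \<in> lists L" "t \<in> lists (insert None (Some ` L))"
      using y(1) unfolding ut us by auto
    moreover have "c (w @ s) = c1 w" if "w \<in> F" for w
    proof -
      have "(None, c, w) \<in> N" using that by (auto simp: N_def)
      then have "H None c w = G None c w" using H(2) by fast
      then show ?thesis unfolding y(2) option.case pre act_def c1_def by simp
    qed
    moreover have "d (w @ s @ a # subst a t) = p d w"
      if "w \<in> F" "a \<in> L" "d \<in> {c1, c2}" for w a d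
    proof -
      have "(Some a, d, w) \<in> N" using that by (auto simp: N_def)
      then have "H (Some a) d w = G (Some a) d w" using H(2) by fast
      then show ?thesis unfolding y(2) using q(2)[OF that(2)] by (simp add: sub act_def Gq)
    qed
    ultimately show "\<exists>s\<in>lists L. \<exists>t\<in>lists (insert None (Some ` L)). \<forall>w\<in>F.
       c (w @ s) = c1 w \<and>
       (\<forall>a\<in>L. c1 (w @ s @ a # subst a t) = c2 w \<and> c2 (w @ s @ a # subst a t) = c2 w)"
      using pc2 by (metis c2_def insertCI)
  qed
qed

text \<open>An infinite word over letters \<open>Inl\<close> and variables \<open>Inr\<close>; a variable is named by the position
  of its first occurrence.\<close>

definition fill :: "(nat \<Rightarrow> 'a) \<Rightarrow> ('a + nat) list \<Rightarrow> 'a list" where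
  "fill a = map (case_sum id a)"

lemma fill_append [simp]: "fill a (x @ y) = fill a x @ fill a y"
  by (simp add: fill_def)

lemma exists_prefix_limit:
  fixes U :: "nat \<Rightarrow> 'b list"
  assumes "\<And>k. \<exists>z. U (Suc k) = U k @ z \<and> z \<noteq> []"
  obtains u where "\<And>k. map u [0..<length (U k)] = U k"
proof -
  have mono: "\<exists>z. U j = U i @ z" if "i \<le> j" for i j
    using that
  proof (induction j rule: dec_induct)
    case (step n)
    then show ?case using assms[of n] by auto
  qed simp
  have len: "k \<le> length (U k)" for k
  proof (induction k)
    case (Suc k)
    then show ?case using assms[of k] by (auto simp: Suc_le_eq neq_Nil_conv)
  qed simp
  show ?thesis
  \<comment> \<open>Stage \<open>Suc i\<close> has length at least \<open>Suc i\<close>, so its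
    entry \<open>i\<close> exists; later stages do not change it.\<close>
  proof (rule that[of "\<lambda>i. U (Suc i) ! i"])
    fix k
    show "map (\<lambda>i. U (Suc i) ! i) [0..<length (U k)] = U k"
    proof (rule nth_equalityI)
      fix i assume "i < length (map (\<lambda>i. U (Suc i) ! i) [0..<length (U k)])"
      then have i: "i < length (U k)" by simp
      have i': "i < length (U (Suc i))" using len[of "Suc i"] by simp
      have "U (Suc i) ! i = U k ! i"
      proof (cases "Suc i \<le> k")
        case True
        then show ?thesis using mono[of "Suc i" k] i' by (auto simp: nth_append)
      next
        case False
        then show ?thesis using mono[of k "Suc i"] i by (auto simp: nth_append)
      qed
      then show "map (\<lambda>i. U (Suc i) ! i) [0..<length (U k)] ! i = U k ! i" using i by simp
    qed simp
  qed
qed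

text \<open>The infinite word grows by segments \<open>s\<close>, new variable, \<open>t\<close>. If
  all instances of the part built so far have \<open>c1\<close> and \<open>c2\<close> equal to
  \<open>b\<close>, appending \<open>s\<close> gives colour \<open>b\<close> right before the new
  variable, and after the whole segment \<open>c1\<close> and \<open>c2\<close> are \<open>b\<close>
  again for every value of the variable.\<close>

theorem carlson_simpson:
  fixes L :: "'a set" and c :: "'a list \<Rightarrow> bool"
  assumes "finite L" "L \<noteq> {}"
  obtains u :: "nat \<Rightarrow> 'a + nat" and b where
    "\<And>i x. u i = Inl x \<Longrightarrow> x \<in> L"
    "\<And>i s. u i = Inr s \<Longrightarrow> s \<le> i \<and> u s = Inr s"
    "infinite {s. u s = Inr s}"
    "\<And>s a. u s = Inr s \<Longrightarrow> (\<And>j. a j \<in> L) \<Longrightarrow> c (fill a (map u [0..<s])) = b"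
proof -
  obtain c1 c2 :: "'a list \<Rightarrow> bool" where inv: "\<And>F. finite F \<Longrightarrow>
       \<exists>s\<in>lists L. \<exists>t\<in>lists (insert None (Some ` L)). \<forall>w\<in>F.
       c (w @ s) = c1 w \<and>
       (\<forall>a\<in>L. c1 (w @ s @ a # subst a t) = c2 w \<and> c2 (w @ s @ a # subst a t) = c2 w)"
    using approximately_invariant_colourings[OF assms(1), of c] by blast
  define b where "b = c2 []"
  define good where "good U \<longleftrightarrow>
      (\<forall>i<length U. (\<forall>x. U ! i = Inl x \<longrightarrow> x \<in> L) \<and>
        (\<forall>s. U ! i = Inr s \<longrightarrow> s \<le> i \<and> U ! s = Inr s)) \<and>
      (\<forall>s<length U. U ! s = Inr s \<longrightarrow> (\<forall>a. (\<forall>j. a j \<in> L) \<longrightarrow> c (fill a (take s U)) = b)) \<and>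
      (\<forall>a. (\<forall>j. a j \<in> L) \<longrightarrow> c1 (fill a U) = b \<and> c2 (fill a U) = b)"
    for U :: "('a + nat) list"
  \<comment> \<open>The new variable gets its own position as name, and each \<open>None\<close> in
    \<open>t\<close> repeats it.\<close>
  define grow where "grow U s t = U @ map Inl s @ Inr (length U + length s) #
      map (case_option (Inr (length U + length s)) Inl) t"
    for U :: "('a + nat) list" and s t
  have fill_grow: "fill a (grow U s t) =
      fill a U @ s @ a (length U + length s) # subst (a (length U + length s)) t" for a U s t
    by (auto simp: fill_def grow_def subst_def o_def split: option.splits)
  \<comment> \<open>The empty word need not be good: only its \<open>c2\<close>-value is
    \<open>b\<close> by definition. One segment with its variable replaced by a fixed letter makes
    the \<open>c1\<close>-value equal to \<open>b\<close> as well.\<close>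
  have base: "\<exists>U. good U"
  proof -
    obtain s t where st: "s \<in> lists L" "t \<in> lists (insert None (Some ` L))"
      "\<And>a. a \<in> L \<Longrightarrow> c1 (s @ a # subst a t) = b \<and> c2 (s @ a # subst a t) = b"
      using inv[of "{[]}"] by (auto simp: b_def)
    obtain a where a: "a \<in> L" using assms by blast
    define W where "W = s @ a # subst a t"
    have "set W \<subseteq> L" using st a by (auto simp: W_def subst_def split: option.splits)
    moreover have "c1 W = b" "c2 W = b" using st(3)[OF a] by (simp_all add: W_def)
    ultimately have "good (map Inl W)"
      unfolding good_def by (auto simp: fill_def o_def dest: nth_mem)
    then show ?thesis by blast
  qed
  have step: "\<exists>s t. good (grow U s t)" if U: "good U" for U
  proof -
    have U1: "x \<in> L" if "i < length U" "U ! i = Inl x" for i x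
      using U that unfolding good_def by blast
    have U2: "r \<le> i \<and> U ! r = Inr r" if "i < length U" "U ! i = Inr r" for i r
      using U that unfolding good_def by blast
    have U3: "c (fill a (take r U)) = b" if "r < length U" "U ! r = Inr r" "\<And>j. a j \<in> L" for r a
      using U that unfolding good_def by blast
    have U4: "c1 (fill a U) = b" "c2 (fill a U) = b" if "\<And>j. a j \<in> L" for a
      using U that unfolding good_def by blast+
    \<comment> \<open>All instances of \<open>U\<close> must be served by one choice of
      \<open>s\<close> and \<open>t\<close>; finiteness of the alphabet makes them finitely
      many.\<close>
    define F where "F = (\<lambda>a. fill a U) ` {a. \<forall>j. a j \<in> L}"
    have "F \<subseteq> {w. set w \<subseteq> L \<and> length w = length U}"
    proof
      fix w assume "w \<in> F"
      then obtain a where a: "\<And>j. a j \<in> L" and w: "w = fill a U" by (auto simp: F_def)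
      have "w ! i \<in> L" if "i < length U" for i
        using U1[OF that] that a unfolding w fill_def by (cases "U ! i") auto
      moreover have "length w = length U" by (simp add: w fill_def)
      ultimately show "w \<in> {w. set w \<subseteq> L \<and> length w = length U}"
        by (auto simp: in_set_conv_nth)
    qed
    then have "finite F" using finite_lists_length_eq[OF assms(1)] by (rule finite_subset)
    then obtain s t where st: "s \<in> lists L" "t \<in> lists (insert None (Some ` L))"
      and c: "\<And>w. w \<in> F \<Longrightarrow> c (w @ s) = c1 w"
      and c12: "\<And>w a. w \<in> F \<Longrightarrow> a \<in> L \<Longrightarrow>
        c1 (w @ s @ a # subst a t) = c2 w \<and> c2 (w @ s @ a # subst a t) = c2 w"
      using inv[of F] by blast
    let ?n = "length U" and ?m = "length U + length s"
    have nxt: "grow U s t ! i = (if i < ?n then U ! i else if i < ?m then Inl (s ! (i - ?n))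
        else if i = ?m then Inr ?m else case_option (Inr ?m) Inl (t ! (i - Suc ?m)))"
      if "i < length (grow U s t)" for i
      using that unfolding grow_def
      by (auto simp: nth_append nth_Cons' nth_map)
    have len: "length (grow U s t) = Suc (?m + length t)" by (simp add: grow_def)
    have inr: "r = ?m \<and> ?m \<le> i"
      if i: "i < length (grow U s t)" "\<not> i < ?n" and r: "grow U s t ! i = Inr r" for i r
    proof -
      have eq: "(if i < ?n then U ! i else if i < ?m then Inl (s ! (i - ?n))
        else if i = ?m then Inr ?m else case_option (Inr ?m) Inl (t ! (i - Suc ?m))) = Inr r"
        using nxt[OF i(1)] r by (rule trans[OF sym])
      then have "\<not> i < ?m" using i(2) by (auto split: if_splits)
      then show ?thesis using i(2) eq by (cases "t ! (i - Suc ?m)") (simp_all split: if_splits)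
    qed
    have "good (grow U s t)"
      unfolding good_def
    proof (intro conjI allI impI)
      fix i x assume i: "i < length (grow U s t)" and x: "grow U s t ! i = Inl x"
      show "x \<in> L"
      proof (cases "i < ?n")
        case True
        then show ?thesis using U1[of i x] x nxt[OF i] by simp
      next
        case False
        show ?thesis
        proof (cases "i < ?m")
          case True
          then have "s ! (i - ?n) \<in> set s" using False by (intro nth_mem) auto
          then show ?thesis using False True x nxt[OF i] st(1) by auto
        next
          case F2: False
          then have "i \<noteq> ?m" using x nxt[OF i] False by auto
          then have "t ! (i - Suc ?m) \<in> set t" using F2 i len by (intro nth_mem) auto
          then show ?thesis using False F2 \<open>i \<noteq> ?m\<close> x nxt[OF i] st(2)
            by (auto split: option.splits)
        qed
      qed
    next
      fix i r assume i: "i < length (grow U s t)" and r: "grow U s t ! i = Inr r"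
      have "r \<le> i \<and> grow U s t ! r = Inr r"
      proof (cases "i < ?n")
        case True
        then have "U ! i = Inr r" using r nxt[OF i] by simp
        then have "r \<le> i" "U ! r = Inr r" using U2[OF True] by simp_all
        then show ?thesis using nxt[of r] True i by simp
      next
        case False
        then have "r = ?m \<and> r \<le> i" using inr[OF i] r by simp
        then show ?thesis using nxt[of r] i by simp
      qed
      then show "r \<le> i" "grow U s t ! r = Inr r" by auto
    next
      fix r and a :: "nat \<Rightarrow> 'a"
      assume r: "r < length (grow U s t)" "grow U s t ! r = Inr r" and a: "\<forall>j. a j \<in> L"
      show "c (fill a (take r (grow U s t))) = b"
      proof (cases "r < ?n")
        case True
        then show ?thesis using U3[of r a] r nxt[OF r(1)] a by (simp add: grow_def)
      next
        case False
        then have "r = ?m" using inr[OF r(1)] r(2) by simp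
        then have "fill a (take r (grow U s t)) = fill a U @ s"
          by (simp add: grow_def fill_def o_def)
        moreover have "fill a U \<in> F" using a by (auto simp: F_def)
        ultimately show ?thesis using c U4 a by simp
      qed
    next
      fix a :: "nat \<Rightarrow> 'a" assume a: "\<forall>j. a j \<in> L"
      have "fill a U \<in> F" using a by (auto simp: F_def)
      then show "c1 (fill a (grow U s t)) = b" "c2 (fill a (grow U s t)) = b"
        using c12[of "fill a U" "a ?m"] a U4(2)[of a] by (simp_all add: fill_grow)
    qed
    then show ?thesis by blast
  qed
  have "\<exists>U. \<forall>k. good (U k) \<and> (\<exists>s t. U (Suc k) = grow (U k) s t)"
    by (rule dependent_nat_choice) (use base step in blast)+
  then obtain U where U: "\<And>k. good (U k)" "\<And>k. \<exists>s t. U (Suc k) = grow (U k) s t"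
    by blast
  have ext: "\<exists>z. U (Suc k) = U k @ z \<and> z \<noteq> []" for k
    using U(2)[of k] by (auto simp: grow_def)
  obtain u where u: "\<And>k. map u [0..<length (U k)] = U k"
    using exists_prefix_limit[of U] ext by blast
  have u_nth: "u i = U k ! i" if "i < length (U k)" for i k
    using u[of k] that by (metis add_0 nth_map_upt diff_zero)
  have len: "k \<le> length (U k)" for k
  proof (induction k)
    case (Suc k)
    then show ?case using ext[of k] by (auto simp: Suc_le_eq neq_Nil_conv)
  qed simp
  have lt: "i < length (U (Suc i))" for i using len[of "Suc i"] by simp
  have good: "good (U (Suc i))" for i by (rule U(1))
  show ?thesis
  proof (rule that[of u b])
    show "x \<in> L" if "u i = Inl x" for i x
      using good[of i] lt[of i] that u_nth[OF lt] unfolding good_def by metis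
    show "s \<le> i \<and> u s = Inr s" if "u i = Inr s" for i s
    proof -
      have "U (Suc i) ! i = Inr s" using that u_nth[OF lt] by simp
      then have "s \<le> i \<and> U (Suc i) ! s = Inr s"
        using good[of i] lt[of i] unfolding good_def by blast
      then show ?thesis using u_nth[of s "Suc i"] lt[of i] by simp
    qed
    show "infinite {s. u s = Inr s}"
      unfolding infinite_nat_iff_unbounded_le
    proof
      fix k
      obtain s t where st: "U (Suc k) = grow (U k) s t" using U(2) by blast
      let ?m = "length (U k) + length s"
      have "?m < length (U (Suc k))" "U (Suc k) ! ?m = Inr ?m"
        unfolding st by (simp_all add: grow_def nth_append)
      then have "u ?m = Inr ?m" using u_nth by metis
      moreover have "k \<le> ?m" using len[of k] by simp
      ultimately show "\<exists>n\<ge>k. n \<in> {s. u s = Inr s}" by blast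
    qed
    show "c (fill a (map u [0..<s])) = b" if "u s = Inr s" "\<And>j. a j \<in> L" for s a
    proof -
      have "map u [0..<s] = take s (U (Suc s))"
        using lt[of s] by (subst u[symmetric]) (simp add: take_map take_upt)
      moreover have "U (Suc s) ! s = Inr s" using that u_nth[OF lt] by simp
      ultimately show ?thesis
        using good[of s] lt[of s] that(2) unfolding good_def by simp
    qed
  qed
qed

section \<open>Abstract Ellentuck theorem\<close>

lemma coarser_refl: "coarser E E"
  unfolding coarser_def
proof
  fix X assume "X \<in> UNIV // E"
  then show "\<exists>\<C>\<subseteq>UNIV // E. X = \<Union>\<C>" by (intro exI[of _ "{X}"]) auto
qed

lemma coarser_trans:
  assumes "coarser E F" "coarser F G"
  shows "coarser E G"
  unfolding coarser_def
proof
  fix X assume "X \<in> UNIV // E"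
  then obtain \<C> where C: "\<C> \<subseteq> UNIV // F" "X = \<Union>\<C>"
    using assms(1) unfolding coarser_def by blast
  have "X = \<Union>{Z \<in> UNIV // G. Z \<subseteq> X}"
  proof
    show "X \<subseteq> \<Union>{Z \<in> UNIV // G. Z \<subseteq> X}"
    proof
      fix x assume "x \<in> X"
      then obtain Y where Y: "Y \<in> \<C>" "x \<in> Y" using C(2) by blast
      then obtain \<D> where "\<D> \<subseteq> UNIV // G" "Y = \<Union>\<D>"
        using C(1) assms(2) unfolding coarser_def by (meson subsetD)
      then show "x \<in> \<Union>{Z \<in> UNIV // G. Z \<subseteq> X}" using Y C(2) by blast
    qed
  qed blast
  then show "\<exists>\<C>\<subseteq>UNIV // G. X = \<Union>\<C>"
    by (intro exI[of _ "{Z \<in> UNIV // G. Z \<subseteq> X}"]) simp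
qed

text \<open>The hypotheses replace Todorcevic's axioms A.1--A.4: the depth of \<open>approx n A\<close> in \<open>B\<close> is
  the \<open>m\<close> with \<open>class_min n A = class_min m B\<close>.\<close>

locale ellentuck_space =
  fixes R :: "nat rel set"
  assumes approx_inj: "A \<in> R \<Longrightarrow> B \<in> R \<Longrightarrow> approx n A = approx m B \<Longrightarrow> n = m"
    and approx_mono: "A \<in> R \<Longrightarrow> B \<in> R \<Longrightarrow> approx n A = approx n B \<Longrightarrow> k \<le> n \<Longrightarrow> approx k A = approx k B"
    and approx_class_min: "A \<in> R \<Longrightarrow> B \<in> R \<Longrightarrow> approx n A = approx n B \<Longrightarrow> class_min n A = class_min n B"
    and class_min_mono: "A \<in> R \<Longrightarrow> class_min n A \<le> class_min m A \<longleftrightarrow> n \<le> m"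
    and depth_exists: "A \<in> R \<Longrightarrow> B \<in> R \<Longrightarrow> coarser A B \<Longrightarrow> \<exists>m. class_min n A = class_min m B"
    and amalgamation: "A \<in> R \<Longrightarrow> B \<in> R \<Longrightarrow> coarser A B \<Longrightarrow> class_min n A = class_min m B \<Longrightarrow>
      \<exists>C\<in>R. coarser C B \<and> approx m C = approx m B \<and>
        basic_set R (approx n A) C \<subseteq> basic_set R (approx n A) A"
    and fusion_limit: "(\<And>i. As i \<in> R) \<Longrightarrow> (\<And>i. coarser (As (Suc i)) (As i)) \<Longrightarrow>
      (\<And>i. approx (n + i) (As (Suc i)) = approx (n + i) (As i)) \<Longrightarrow>
      \<exists>C\<in>R. \<forall>i. coarser C (As i) \<and> approx (n + i) C = approx (n + i) (As i)"
    and pigeonhole: "B \<in> R \<Longrightarrow>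
      \<exists>A\<in>basic_set R (approx n B) B.
        (\<forall>C\<in>basic_set R (approx n B) A. approx (Suc n) C \<in> \<O>) \<or>
        (\<forall>C\<in>basic_set R (approx n B) A. approx (Suc n) C \<notin> \<O>)"
begin

section \<open>Basic sets and fusion\<close>

abbreviation "basic \<equiv> basic_set R"

lemma basicI: "A \<in> R \<Longrightarrow> coarser A B \<Longrightarrow> approx n A = a \<Longrightarrow> A \<in> basic a B"
  by (auto simp: basic_set_def)

lemma basicD:
  assumes "A \<in> basic a B"
  shows "A \<in> R" "coarser A B" "\<exists>n. a = approx n A"
  using assms by (auto simp: basic_set_def)

lemma basic_approx:
  assumes "A \<in> basic (approx n B) C" "B \<in> R"
  shows "approx n A = approx n B"
proof -
  obtain k where k: "approx n B = approx k A" using basicD(3)[OF assms(1)] by blast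
  then show ?thesis using approx_inj[OF assms(2) basicD(1)[OF assms(1)] k] by simp
qed

lemma basic_self: "A \<in> R \<Longrightarrow> A \<in> basic (approx n A) A"
  by (blast intro: basicI coarser_refl)

lemma basic_mono: "coarser A B \<Longrightarrow> basic a A \<subseteq> basic a B"
  by (auto simp: basic_set_def intro: coarser_trans)

lemma basic_antimono:
  assumes "A \<in> R" "k \<le> n"
  shows "basic (approx n A) B \<subseteq> basic (approx k A) B"
proof
  fix C assume C: "C \<in> basic (approx n A) B"
  then have "approx k C = approx k A"
    using approx_mono[OF _ assms(1) _ assms(2)] basic_approx[OF C assms(1)] basicD(1)[OF C] by blast
  then show "C \<in> basic (approx k A) B" using basicD[OF C] by (blast intro: basicI)
qed

text \<open>Requirements that a fusion can meet at all approximations simultaneously: heredity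
  preserves them under later shrinking, and \<open>D a {}\<close> disposes of approximations with no
  extension below the current relation.\<close>

definition dense_below :: "nat \<Rightarrow> nat rel \<Rightarrow> (nat rel \<Rightarrow> nat rel set \<Rightarrow> bool) \<Rightarrow> bool" where
  "dense_below n0 B D \<longleftrightarrow> (\<forall>a. D a {}) \<and> (\<forall>a Y Z. D a Y \<longrightarrow> Z \<subseteq> Y \<longrightarrow> D a Z) \<and>
    (\<forall>A\<in>basic (approx n0 B) B. \<forall>n\<ge>n0. \<exists>A'\<in>basic (approx n A) A. D (approx n A) (basic (approx n A) A'))"

text \<open>Only finitely many approximations end at the \<open>m\<close>-th minimum of
  \<open>A\<close>, because they are relations on one finite segment. They are treated one by one,
  and amalgamation turns each shrinking into one that leaves \<open>approx m A\<close>
  untouched.\<close>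

lemma fusion_step:
  assumes D: "dense_below n0 B D" and B: "B \<in> R"
    and A: "A \<in> basic (approx n0 B) B" and "n0 \<le> m"
  shows "\<exists>C\<in>R. coarser C A \<and> approx m C = approx m A \<and>
    (\<forall>n\<ge>n0. \<forall>E\<in>basic (approx n0 B) A. class_min n E = class_min m A \<longrightarrow>
       D (approx n E) (basic (approx n E) C))"
proof -
  define F where "F = {approx n E |n E. n0 \<le> n \<and> E \<in> basic (approx n0 B) A \<and> class_min n E = class_min m A}"
  have AR: "A \<in> R" "coarser A B" using basicD[OF A] by auto
  have "F \<subseteq> Pow ({..<class_min m A} \<times> {..<class_min m A})"
    by (auto simp: F_def approx_def)
  then have "finite F" by (rule finite_subset) simp
  have mono: "D a Z" if "D a Y" "Z \<subseteq> Y" for a Y Z using D that unfolding dense_below_def by blast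
  have "\<exists>C\<in>R. coarser C A \<and> approx m C = approx m A \<and> (\<forall>a\<in>G. D a (basic a C))" if "G \<subseteq> F" for G
    using finite_subset[OF that \<open>finite F\<close>] that
  proof (induction G rule: finite_induct)
    case empty
    then show ?case using AR coarser_refl by blast
  next
    case (insert a G)
    then obtain C where C: "C \<in> R" "coarser C A" "approx m C = approx m A" "\<forall>a\<in>G. D a (basic a C)"
      by auto
    show ?case
    proof (cases "basic a C = {}")
      case True
      then have "D a (basic a C)" using D by (simp add: dense_below_def)
      then show ?thesis using C by (intro bexI[of _ C]) auto
    next
      case False
      then obtain E' where E': "E' \<in> basic a C" by blast
      obtain n E where a: "a = approx n E" "n0 \<le> n" and E: "E \<in> basic (approx n0 B) A"
        and En: "class_min n E = class_min m A"
        using insert.prems by (auto simp: F_def)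
      have ER: "E \<in> R" using basicD[OF E] by simp
      have E'R: "E' \<in> R" "coarser E' C" using basicD[OF E'] by auto
      have E'n: "approx n E' = approx n E" using basic_approx[OF E'[unfolded a] ER] .
      have "approx n0 E' = approx n0 B"
        using approx_mono[OF E'R(1) ER E'n a(2)] basic_approx[OF E B] by simp
      then have "E' \<in> basic (approx n0 B) B"
        using E'R C AR by (blast intro: basicI coarser_trans)
      then obtain E2 where E2: "E2 \<in> basic a E'" "D a (basic a E2)"
        using D a E'n unfolding dense_below_def by metis
      have E2R: "E2 \<in> R" "coarser E2 C" using basicD[OF E2(1)] E'R coarser_trans by blast+
      have E2n: "approx n E2 = a" using basic_approx[OF E2(1)[unfolded a] ER] a by simp
      \<comment> \<open>The depth of \<open>a\<close> in \<open>C\<close> is still \<open>m\<close>,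
        as \<open>C\<close> has the same \<open>m\<close>-th approximation as \<open>A\<close>; this
        is what amalgamation requires.\<close>
      have "class_min n E2 = class_min m C"
        using approx_class_min[OF E2R(1) ER, of n] approx_class_min[OF C(1) AR(1) C(3)] E2n a En by simp
      then obtain C' where C': "C' \<in> R" "coarser C' C" "approx m C' = approx m C"
        "basic a C' \<subseteq> basic a E2"
        using amalgamation[OF E2R(1) C(1) E2R(2)] E2n by metis
      have "D a' (basic a' C')" if "a' \<in> insert a G" for a'
      proof (cases "a' = a")
        case True
        then show ?thesis using mono[OF E2(2) C'(4)] by simp
      next
        case False
        then show ?thesis using that C(4) mono[OF _ basic_mono[OF C'(2)]] by blast
      qed
      then show ?thesis
        using C' C by (intro bexI[of _ C']) (auto intro: coarser_trans)
    qed
  qed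
  from this[of F] obtain C where "C \<in> R" "coarser C A" "approx m C = approx m A" "\<forall>a\<in>F. D a (basic a C)"
    by blast
  then show ?thesis by (intro bexI[of _ C]) (auto simp: F_def)
qed

text \<open>Stage \<open>i\<close> settles the approximations of depth \<open>n0 + i\<close>. Every
  approximation below the limit that extends \<open>approx n0 B\<close> has depth at least
  \<open>n0\<close>, so some stage has dealt with it.\<close>

lemma fusion:
  assumes D: "dense_below n0 B D" and B: "B \<in> R"
  obtains C where "C \<in> basic (approx n0 B) B"
    "\<And>A n. A \<in> basic (approx n0 B) C \<Longrightarrow> n0 \<le> n \<Longrightarrow> D (approx n A) (basic (approx n A) C)"
proof -
  have mono: "D a Z" if "D a Y" "Z \<subseteq> Y" for a Y Z using D that unfolding dense_below_def by blast
  let ?P = "\<lambda>(_::nat) A. A \<in> basic (approx n0 B) B"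
  let ?Q = "\<lambda>i A C. coarser C A \<and> approx (n0 + i) C = approx (n0 + i) A \<and>
    (\<forall>n\<ge>n0. \<forall>E\<in>basic (approx n0 B) A. class_min n E = class_min (n0 + i) A \<longrightarrow>
       D (approx n E) (basic (approx n E) C))"
  have "\<exists>A. \<forall>i. ?P i (A i) \<and> ?Q i (A i) (A (Suc i))"
  proof (rule dependent_nat_choice)
    show "\<exists>A. ?P 0 A" using basic_self[OF B] by blast
    fix A and i :: nat assume A: "?P i A"
    obtain C where C: "C \<in> R" "?Q i A C"
      using fusion_step[OF D B A, of "n0 + i"] by auto
    have AR: "A \<in> R" "coarser A B" using basicD[OF A] by auto
    have "approx n0 C = approx n0 A"
      using approx_mono[OF C(1) AR(1), of "n0 + i" n0] C(2) by simp
    then have "?P i C" using C AR basic_approx[OF A B] by (blast intro: basicI coarser_trans)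
    then show "\<exists>C. ?P (Suc i) C \<and> ?Q i A C" using C(2) by blast
  qed
  then obtain A where A: "\<And>i. A i \<in> basic (approx n0 B) B" and Q: "\<And>i. ?Q i (A i) (A (Suc i))"
    by blast
  have AR: "A i \<in> R" for i using basicD[OF A] by blast
  obtain C where C: "C \<in> R" "\<And>i. coarser C (A i)" "\<And>i. approx (n0 + i) C = approx (n0 + i) (A i)"
    using fusion_limit[of A n0] AR Q by blast
  show ?thesis
  proof (rule that)
    have "approx n0 C = approx n0 B" using C(3)[of 0] basic_approx[OF A B, of 0] by simp
    then show "C \<in> basic (approx n0 B) B"
      using C(1,2) basicD(2)[OF A[of 0]] by (blast intro: basicI coarser_trans)
    fix E n assume E: "E \<in> basic (approx n0 B) C" and n: "n0 \<le> n"
    have ER: "E \<in> R" "coarser E C" using basicD[OF E] by auto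
    obtain m where m: "class_min n E = class_min m C"
      using depth_exists[OF ER(1) C(1) ER(2)] by blast
    have "approx n0 E = approx n0 C" using \<open>approx n0 C = approx n0 B\<close> basic_approx[OF E B] by simp
    then have "class_min n0 C \<le> class_min m C"
      using approx_class_min[OF ER(1) C(1)] class_min_mono[OF ER(1)] n m by metis
    then have "n0 \<le> m" using class_min_mono[OF C(1)] by simp
    then obtain i where i: "m = n0 + i" using le_Suc_ex by blast
    have "class_min n E = class_min (n0 + i) (A i)"
      using m approx_class_min[OF C(1) AR C(3)] i by simp
    moreover have "E \<in> basic (approx n0 B) (A i)" using basic_mono[OF C(2)] E by blast
    ultimately have "D (approx n E) (basic (approx n E) (A (Suc i)))" using Q n by blast
    then show "D (approx n E) (basic (approx n E) C)" by (rule mono[OF _ basic_mono[OF C(2)]])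
  qed
qed

section \<open>The Ellentuck topology and the Ramsey property\<close>

lemma openin_ellentuck_iff:
  "openin (ellentuck_topology R) U \<longleftrightarrow> U \<subseteq> R \<and> (\<forall>A\<in>U. \<exists>n. basic (approx n A) A \<subseteq> U)"
proof
  let ?\<B> = "{basic a B |a B. a \<in> approximations R \<and> B \<in> R}"
  assume "openin (ellentuck_topology R) U"
  then have "generate_topology_on ?\<B> U"
    unfolding ellentuck_topology_def openin_topology_generated_by_iff .
  then show "U \<subseteq> R \<and> (\<forall>A\<in>U. \<exists>n. basic (approx n A) A \<subseteq> U)"
  proof (induction rule: generate_topology_on.induct)
    case (Int U V)
    show ?case
    proof (intro conjI ballI)
      fix A assume A: "A \<in> U \<inter> V"
      then obtain n m where nm: "basic (approx n A) A \<subseteq> U" "basic (approx m A) A \<subseteq> V"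
        using Int.IH by blast
      have "A \<in> R" using A Int.IH by blast
      then have "basic (approx (max n m) A) A \<subseteq> U \<inter> V"
        using nm basic_antimono[of A n "max n m" A] basic_antimono[of A m "max n m" A] by auto
      then show "\<exists>n. basic (approx n A) A \<subseteq> U \<inter> V" by blast
    qed (use Int.IH in blast)
  next
    case (UN K)
    show ?case
    proof (intro conjI ballI)
      show "\<Union>K \<subseteq> R" using UN.IH by (intro Union_least) blast
      fix A assume "A \<in> \<Union>K"
      then obtain U where U: "U \<in> K" "A \<in> U" by blast
      then obtain n where "basic (approx n A) A \<subseteq> U" using UN.IH[OF U(1)] by blast
      then show "\<exists>n. basic (approx n A) A \<subseteq> \<Union>K" using U(1) by (intro exI[of _ n]) blast
    qed
  next
    case (Basis U)
    then obtain a B where U: "U = basic a B" by blast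
    have "\<exists>n. basic (approx n A) A \<subseteq> U" if "A \<in> U" for A
      using that basicD[of A a B] basic_mono[of A B a] unfolding U by blast
    then show ?case using basicD(1) U by blast
  qed simp
next
  assume U: "U \<subseteq> R \<and> (\<forall>A\<in>U. \<exists>n. basic (approx n A) A \<subseteq> U)"
  show "openin (ellentuck_topology R) U"
  proof (subst openin_subopen, intro ballI)
    fix A assume "A \<in> U"
    then obtain n where n: "basic (approx n A) A \<subseteq> U" and A: "A \<in> R" using U by blast
    have "openin (ellentuck_topology R) (basic (approx n A) A)"
      unfolding ellentuck_topology_def
      by (rule topology_generated_by_Basis) (use A in \<open>auto simp: approximations_def\<close>)
    then show "\<exists>T. openin (ellentuck_topology R) T \<and> A \<in> T \<and> T \<subseteq> U"
      using n basic_self[OF A] by blast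
  qed
qed

lemma openin_basic: "A \<in> R \<Longrightarrow> openin (ellentuck_topology R) (basic (approx n A) B)"
  unfolding openin_ellentuck_iff
proof (intro conjI ballI)
  fix C assume "A \<in> R" and C: "C \<in> basic (approx n A) B"
  then have "basic (approx n C) C \<subseteq> basic (approx n A) B"
    using basic_approx[OF C] basicD(2)[OF C] basic_mono by simp
  then show "\<exists>n'. basic (approx n' C) C \<subseteq> basic (approx n A) B" by blast
qed (use basicD(1) in blast)

lemma topspace_ellentuck: "topspace (ellentuck_topology R) = R"
proof -
  have "openin (ellentuck_topology R) R"
    unfolding openin_ellentuck_iff using basicD(1) by blast
  moreover have "topspace (ellentuck_topology R) \<subseteq> R"
    using openin_topspace[of "ellentuck_topology R"] unfolding openin_ellentuck_iff by blast
  ultimately show ?thesis using openin_subset by blast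
qed

text \<open>A member \<open>A\<close> of a nonempty \<open>basic a B\<close> has \<open>a\<close>
  among its approximations, so \<open>A\<close> can replace \<open>B\<close>. The predicate
  \<open>\<Phi>\<close> lets this serve Ramsey and Ramsey null alike.\<close>

lemma homogeneous_iff:
  "(\<forall>a\<in>approximations R. \<forall>B\<in>R. basic a B \<noteq> {} \<longrightarrow> (\<exists>A\<in>basic a B. \<Phi> (basic a A))) \<longleftrightarrow>
   (\<forall>B\<in>R. \<forall>n. \<exists>A\<in>basic (approx n B) B. \<Phi> (basic (approx n B) A))" (is "?L \<longleftrightarrow> ?R")
proof
  assume ?L
  show ?R
  proof (intro ballI allI)
    fix B n assume B: "B \<in> R"
    then have "approx n B \<in> approximations R" "basic (approx n B) B \<noteq> {}"
      using basic_self[OF B] by (auto simp: approximations_def)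
    then show "\<exists>A\<in>basic (approx n B) B. \<Phi> (basic (approx n B) A)" using \<open>?L\<close> B by blast
  qed
next
  assume R: ?R
  show ?L
  proof (intro ballI impI)
    fix a B assume "basic a B \<noteq> {}"
    then obtain A where A: "A \<in> basic a B" by blast
    then obtain n where "a = approx n A" "A \<in> R" "coarser A B" using basicD by blast
    then show "\<exists>A\<in>basic a B. \<Phi> (basic a A)" using R basic_mono by blast
  qed
qed

lemma ramsey_iff: "ramsey R X \<longleftrightarrow> (\<forall>B\<in>R. \<forall>n. \<exists>A\<in>basic (approx n B) B.
    basic (approx n B) A \<subseteq> X \<or> basic (approx n B) A \<inter> X = {})"
  unfolding ramsey_def by (rule homogeneous_iff)

lemma ramsey_null_iff: "ramsey_null R X \<longleftrightarrow>
    (\<forall>B\<in>R. \<forall>n. \<exists>A\<in>basic (approx n B) B. basic (approx n B) A \<inter> X = {})"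
  unfolding ramsey_null_def by (rule homogeneous_iff)

text \<open>Combinatorial forcing: \<open>C\<close> decides every approximation; if it does not accept \<open>approx n B\<close>,
  the pigeonhole lets us shrink \<open>C\<close> so that it rejects every end-extension of \<open>approx n B\<close>.\<close>

lemma open_imp_ramsey:
  assumes X: "openin (ellentuck_topology R) X"
  shows "ramsey R X"
  unfolding ramsey_iff
proof (intro ballI allI)
  fix B n0 assume B: "B \<in> R"
  let ?a = "approx n0 B"
  \<comment> \<open>For \<open>Y = basic a C\<close> this reads: \<open>C\<close> accepts
    \<open>a\<close>, or no member of \<open>basic a C\<close> accepts it.\<close>
  define D1 where "D1 a Y \<longleftrightarrow> Y \<subseteq> X \<or> \<not> (\<exists>A\<in>Y. basic a A \<subseteq> X)" for a Y
  have "dense_below n0 B D1"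
    unfolding dense_below_def
  proof (intro conjI ballI allI impI)
    fix A n assume A: "A \<in> basic ?a B"
    show "\<exists>A'\<in>basic (approx n A) A. D1 (approx n A) (basic (approx n A) A')"
    proof (cases "\<exists>A'\<in>basic (approx n A) A. basic (approx n A) A' \<subseteq> X")
      case False
      then show ?thesis using basic_self[OF basicD(1)[OF A]] by (auto simp: D1_def)
    qed (auto simp: D1_def)
  qed (auto simp: D1_def)
  then obtain C where C: "C \<in> basic ?a B"
    and dec: "\<And>A n. A \<in> basic ?a C \<Longrightarrow> n0 \<le> n \<Longrightarrow> D1 (approx n A) (basic (approx n A) C)"
    using fusion[OF _ B] by metis
  have CR: "C \<in> R" "coarser C B" using basicD[OF C] by auto
  have Ca: "approx n0 C = ?a" using basic_approx[OF C B] .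
  show "\<exists>A\<in>basic ?a B. basic ?a A \<subseteq> X \<or> basic ?a A \<inter> X = {}"
  proof (cases "basic ?a C \<subseteq> X")
    case True
    then show ?thesis using C by blast
  next
    case False
    define rej where "rej a \<longleftrightarrow> \<not> (\<exists>A\<in>basic a C. basic a A \<subseteq> X)" for a
    have rej0: "rej ?a"
      using dec[of C n0] False Ca basic_self[OF CR(1), of n0] by (simp add: D1_def rej_def)
    define D2 where "D2 a Y \<longleftrightarrow> (rej a \<longrightarrow> (\<forall>A\<in>Y. \<forall>n. a = approx n A \<longrightarrow> rej (approx (Suc n) A)))" for a Y
    have "dense_below n0 C D2"
      unfolding dense_below_def
    proof (intro conjI ballI allI impI)
      fix A n assume A: "A \<in> basic (approx n0 C) C" and n: "n0 \<le> n"
      let ?b = "approx n A"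
      have AR: "A \<in> R" "coarser A C" using basicD[OF A] by auto
      have An0: "approx n0 A = ?a" using basic_approx[OF A CR(1)] Ca by simp
      show "\<exists>A'\<in>basic ?b A. D2 ?b (basic ?b A')"
      proof (cases "rej ?b")
        case False
        then show ?thesis using basic_self[OF AR(1)] by (auto simp: D2_def)
      next
        case True
        obtain A' where A': "A' \<in> basic ?b A" and
          ph: "(\<forall>E\<in>basic ?b A'. approx (Suc n) E \<in> {b. rej b}) \<or>
               (\<forall>E\<in>basic ?b A'. approx (Suc n) E \<notin> {b. rej b})"
          using pigeonhole[OF AR(1), of n "{b. rej b}"] by blast
        have A'C: "coarser A' C" using basicD(2)[OF A'] AR coarser_trans by blast
        \<comment> \<open>If no one-step extension were rejected, each would be accepted by
          \<open>C\<close>, as \<open>C\<close> decides; these accepted sets cover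
          \<open>basic ?b A'\<close>, so \<open>A'\<close> would accept the rejected
          \<open>?b\<close>.\<close>
        have "\<not> (\<forall>E\<in>basic ?b A'. approx (Suc n) E \<notin> {b. rej b})"
        proof
          assume acc: "\<forall>E\<in>basic ?b A'. approx (Suc n) E \<notin> {b. rej b}"
          have "basic ?b A' \<subseteq> X"
          proof
            fix E assume E: "E \<in> basic ?b A'"
            have ER: "E \<in> R" "coarser E C" using basicD[OF E] A'C coarser_trans by blast+
            have "approx n0 E = ?a"
              using approx_mono[OF ER(1) AR(1) basic_approx[OF E AR(1)] n] An0 by simp
            then have "E \<in> basic ?a C" using ER by (blast intro: basicI)
            then have "D1 (approx (Suc n) E) (basic (approx (Suc n) E) C)" using dec n by simp
            then have "basic (approx (Suc n) E) C \<subseteq> X" using acc E by (auto simp: D1_def rej_def)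
            moreover have "E \<in> basic (approx (Suc n) E) C" using ER by (blast intro: basicI)
            ultimately show "E \<in> X" by blast
          qed
          moreover have "A' \<in> basic ?b C" using A' basic_mono[OF AR(2)] by blast
          ultimately show False using True by (auto simp: rej_def)
        qed
        then have all: "\<forall>E\<in>basic ?b A'. rej (approx (Suc n) E)" using ph by blast
        have "D2 ?b (basic ?b A')"
          unfolding D2_def
        proof (intro impI ballI allI)
          fix E k assume E: "E \<in> basic ?b A'" and k: "?b = approx k E"
          then have "k = n" using approx_inj[OF AR(1) basicD(1)[OF E]] by blast
          then show "rej (approx (Suc k) E)" using all E by blast
        qed
        then show ?thesis using A' by blast
      qed
    qed (auto simp: D2_def)
    then obtain C2 where C2: "C2 \<in> basic (approx n0 C) C"
      and D2: "\<And>A n. A \<in> basic (approx n0 C) C2 \<Longrightarrow> n0 \<le> n \<Longrightarrow> D2 (approx n A) (basic (approx n A) C2)"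
      using fusion[OF _ CR(1)] by metis
    have C2C: "coarser C2 C" using basicD[OF C2] by blast
    have rej: "rej (approx n A)" if A: "A \<in> basic ?a C2" and n: "n0 \<le> n" for A n
      using n
    proof (induction n rule: dec_induct)
      case base
      then show ?case using rej0 basic_approx[OF A B] by simp
    next
      case (step n)
      have "A \<in> basic (approx n A) C2" using basicD[OF A] by (blast intro: basicI)
      then show ?case using D2[of A n] A step Ca by (auto simp: D2_def)
    qed
    have "basic ?a C2 \<inter> X = {}"
    proof (rule ccontr)
      assume "basic ?a C2 \<inter> X \<noteq> {}"
      then obtain A where A: "A \<in> basic ?a C2" "A \<in> X" by blast
      then obtain n where n: "basic (approx n A) A \<subseteq> X" using X unfolding openin_ellentuck_iff by blast
      have AR: "A \<in> R" "coarser A C" using basicD[OF A(1)] C2C coarser_trans by blast+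
      \<comment> \<open>Rejection is known only from length \<open>n0\<close> on, so the
        neighbourhood of \<open>A\<close> inside \<open>X\<close> is shrunk to such a
        length.\<close>
      let ?N = "max n n0"
      have "basic (approx ?N A) A \<subseteq> X" using n basic_antimono[OF AR(1), of n ?N A] by auto
      moreover have "A \<in> basic (approx ?N A) C" using AR by (blast intro: basicI)
      ultimately show False using rej[OF A(1), of ?N] by (auto simp: rej_def)
    qed
    moreover have "C2 \<in> basic ?a B" using C2 Ca basic_mono[OF CR(2)] by auto
    ultimately show ?thesis by blast
  qed
qed

text \<open>The complement of the closure is open, hence Ramsey; the alternative of missing it would
  place a nonempty open set inside the closure.\<close>

lemma nowhere_dense_imp_ramsey_null:
  assumes "nowhere_dense_in (ellentuck_topology R) S"
  shows "ramsey_null R S"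
  unfolding ramsey_null_iff
proof (intro ballI allI)
  let ?T = "ellentuck_topology R"
  fix B n assume B: "B \<in> R"
  have SR: "S \<subseteq> R" and int: "?T interior_of (?T closure_of S) = {}"
    using assms by (auto simp: nowhere_dense_in_def topspace_ellentuck)
  have "openin ?T (R - ?T closure_of S)"
    using closedin_closure_of[of ?T S] by (simp add: closedin_def topspace_ellentuck)
  then have "ramsey R (R - ?T closure_of S)" by (rule open_imp_ramsey)
  then obtain A where A: "A \<in> basic (approx n B) B"
    and or: "basic (approx n B) A \<subseteq> R - ?T closure_of S \<or>
      basic (approx n B) A \<inter> (R - ?T closure_of S) = {}"
    unfolding ramsey_iff using B by blast
  have "A \<in> basic (approx n B) A" using A by (auto simp: basic_set_def coarser_refl)
  moreover have "\<not> basic (approx n B) A \<subseteq> ?T closure_of S"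
    using interior_of_maximal[of "basic (approx n B) A" "?T closure_of S" ?T]
      openin_basic[OF B, of n A] int calculation by blast
  ultimately have "basic (approx n B) A \<subseteq> R - ?T closure_of S" using or basicD(1) by blast
  then have "basic (approx n B) A \<inter> S = {}"
    using closure_of_subset[of S ?T] SR by (auto simp: topspace_ellentuck)
  then show "\<exists>A\<in>basic (approx n B) B. basic (approx n B) A \<inter> S = {}" using A by blast
qed

lemma ramsey_null_finite_Union:
  fixes N :: "nat \<Rightarrow> nat rel set"
  assumes "\<And>i. ramsey_null R (N i)"
  shows "ramsey_null R (\<Union>i<k. N i)"
proof (induction k)
  case 0
  then show ?case unfolding ramsey_null_iff using basic_self by auto
next
  case (Suc k)
  show ?case
    unfolding ramsey_null_iff
  proof (intro ballI allI)
    fix B n assume B: "B \<in> R"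
    then obtain A where A: "A \<in> basic (approx n B) B" "basic (approx n B) A \<inter> (\<Union>i<k. N i) = {}"
      using Suc unfolding ramsey_null_iff by blast
    have AR: "A \<in> R" "coarser A B" "approx n A = approx n B"
      using basicD[OF A(1)] basic_approx[OF A(1) B] by auto
    then obtain C where C: "C \<in> basic (approx n B) A" "basic (approx n B) C \<inter> N k = {}"
      using assms unfolding ramsey_null_iff by metis
    have "basic (approx n B) C \<subseteq> basic (approx n B) A" using basic_mono basicD(2)[OF C(1)] by blast
    then have "basic (approx n B) C \<inter> (\<Union>i<Suc k. N i) = {}"
      using A(2) C(2) by (auto simp: lessThan_Suc)
    moreover have "C \<in> basic (approx n B) B" using C(1) basic_mono[OF AR(2)] by blast
    ultimately show "\<exists>A\<in>basic (approx n B) B. basic (approx n B) A \<inter> (\<Union>i<Suc k. N i) = {}" by blast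
  qed
qed

text \<open>Infinitely many sets cannot be avoided by one shrinking, so an approximation of length
  \<open>n\<close> is asked to avoid only the first \<open>n\<close>. Since a relation has
  approximations of all lengths, the fusion avoids every one of them.\<close>

lemma ramsey_null_Union:
  fixes N :: "nat \<Rightarrow> nat rel set"
  assumes "\<And>i. ramsey_null R (N i)"
  shows "ramsey_null R (\<Union>i. N i)"
  unfolding ramsey_null_iff
proof (intro ballI allI)
  fix B n0 assume B: "B \<in> R"
  define D where "D a Y \<longleftrightarrow> (\<forall>A\<in>Y. \<forall>n. a = approx n A \<longrightarrow> A \<notin> (\<Union>i<n. N i))" for a Y
  have "dense_below n0 B D"
    unfolding dense_below_def
  proof (intro conjI ballI allI impI)
    fix A n assume "A \<in> basic (approx n0 B) B"
    then have A: "A \<in> R" using basicD by blast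
    have "ramsey_null R (\<Union>i<n. N i)" by (rule ramsey_null_finite_Union[OF assms])
    from this[unfolded ramsey_null_iff, rule_format, OF A, of n]
    obtain A' where A': "A' \<in> basic (approx n A) A" "basic (approx n A) A' \<inter> (\<Union>i<n. N i) = {}"
      by blast
    have "D (approx n A) (basic (approx n A) A')"
      unfolding D_def
    proof (intro ballI allI impI)
      fix E k assume E: "E \<in> basic (approx n A) A'" and k: "approx n A = approx k E"
      then have "k = n" using approx_inj[OF A basicD(1)[OF E]] by blast
      then show "E \<notin> (\<Union>i<k. N i)" using E A'(2) by blast
    qed
    then show "\<exists>A'\<in>basic (approx n A) A. D (approx n A) (basic (approx n A) A')" using A' by blast
  qed (auto simp: D_def)
  then obtain C where C: "C \<in> basic (approx n0 B) B"
    and D: "\<And>A n. A \<in> basic (approx n0 B) C \<Longrightarrow> n0 \<le> n \<Longrightarrow> D (approx n A) (basic (approx n A) C)"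
    using fusion[OF _ B] by metis
  have "A \<notin> N i" if A: "A \<in> basic (approx n0 B) C" for A i
  proof -
    let ?n = "max n0 (Suc i)"
    have "A \<in> basic (approx ?n A) C" using basicD[OF A] by (blast intro: basicI)
    then have "A \<notin> (\<Union>i<?n. N i)" using D[OF A, of ?n] by (auto simp: D_def)
    then show ?thesis by (auto simp: max_def)
  qed
  then show "\<exists>A\<in>basic (approx n0 B) B. basic (approx n0 B) A \<inter> (\<Union>i. N i) = {}"
    using C by blast
qed

text \<open>Inside a basic set contained in the closure, the Ramsey null property yields a smaller
  nonempty open set that misses \<open>S\<close>.\<close>

lemma ramsey_null_imp_nowhere_dense:
  assumes "ramsey_null R S" "S \<subseteq> R"
  shows "nowhere_dense_in (ellentuck_topology R) S"
proof -
  let ?T = "ellentuck_topology R"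
  have False if A: "A \<in> ?T interior_of (?T closure_of S)" for A
  proof -
    have "openin ?T (?T interior_of (?T closure_of S))" by simp
    then obtain n where n: "basic (approx n A) A \<subseteq> ?T closure_of S" and AR: "A \<in> R"
      using A interior_of_subset[of ?T "?T closure_of S"] unfolding openin_ellentuck_iff by blast
    obtain A' where A': "A' \<in> basic (approx n A) A" "basic (approx n A) A' \<inter> S = {}"
      using assms(1) AR unfolding ramsey_null_iff by blast
    have "A' \<in> ?T closure_of S" using n A' by blast
    moreover have "A' \<in> basic (approx n A) A'" using A'(1) by (auto simp: basic_set_def coarser_refl)
    ultimately show False using A'(2) openin_basic[OF AR, of n A'] by (auto simp: in_closure_of)
  qed
  then show ?thesis using assms(2) by (auto simp: nowhere_dense_in_def topspace_ellentuck)
qed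

text \<open>In this topology meagre sets are already nowhere dense, so a constant sequence witnesses
  meagreness.\<close>

lemma meagre_iff_ramsey_null:
  assumes "X \<subseteq> R"
  shows "meagre_in (ellentuck_topology R) X \<longleftrightarrow> ramsey_null R X"
proof
  assume "meagre_in (ellentuck_topology R) X"
  then show "ramsey_null R X"
    using ramsey_null_Union nowhere_dense_imp_ramsey_null unfolding meagre_in_def by blast
next
  assume "ramsey_null R X"
  then have "nowhere_dense_in (ellentuck_topology R) X"
    using ramsey_null_imp_nowhere_dense assms by blast
  then show "meagre_in (ellentuck_topology R) X"
    unfolding meagre_in_def by (intro exI[of _ "\<lambda>_. X"]) simp
qed

text \<open>After shrinking to a basic set disjoint from \<open>M\<close>, the sets \<open>X\<close>
  and \<open>U\<close> coincide there.\<close>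

lemma baire_imp_ramsey:
  assumes "has_baire_property_in (ellentuck_topology R) X"
  shows "ramsey R X"
proof -
  obtain U M where U: "openin (ellentuck_topology R) U" and M: "meagre_in (ellentuck_topology R) M"
    and X: "X = sym_diff U M"
    using assms unfolding has_baire_property_in_def by blast
  have "ramsey_null R M"
    using M ramsey_null_Union nowhere_dense_imp_ramsey_null unfolding meagre_in_def by blast
  note null = this[unfolded ramsey_null_iff, rule_format]
  note ram = open_imp_ramsey[OF U, unfolded ramsey_iff, rule_format]
  show ?thesis
    unfolding ramsey_iff
  proof (intro ballI allI)
    fix B n assume B: "B \<in> R"
    obtain A where A: "A \<in> basic (approx n B) B" "basic (approx n B) A \<inter> M = {}"
      using null[OF B] by blast
    have AR: "A \<in> R" "coarser A B" "approx n A = approx n B"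
      using basicD[OF A(1)] basic_approx[OF A(1) B] by auto
    obtain C where C: "C \<in> basic (approx n B) A"
      "basic (approx n B) C \<subseteq> U \<or> basic (approx n B) C \<inter> U = {}"
      using ram[OF AR(1), of n] AR(3) by auto
    have "basic (approx n B) C \<subseteq> basic (approx n B) A" using basic_mono basicD(2)[OF C(1)] by blast
    then have "basic (approx n B) C \<subseteq> X \<or> basic (approx n B) C \<inter> X = {}"
      using A(2) C(2) X by blast
    moreover have "C \<in> basic (approx n B) B" using C(1) basic_mono[OF AR(2)] by blast
    ultimately show "\<exists>A\<in>basic (approx n B) B. basic (approx n B) A \<subseteq> X \<or> basic (approx n B) A \<inter> X = {}"
      by blast
  qed
qed

text \<open>\<open>U\<close> is the Ellentuck interior of \<open>X\<close>. The remainder is Ramsey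
  null: a basic set around \<open>A\<close> inside \<open>X\<close> lies in \<open>U\<close>, and
  one that misses \<open>X\<close> misses the remainder too.\<close>

lemma ramsey_imp_baire:
  assumes X: "X \<subseteq> R" "ramsey R X"
  shows "has_baire_property_in (ellentuck_topology R) X"
proof -
  define U where "U = {A \<in> X. \<exists>n. basic (approx n A) A \<subseteq> X}"
  have sub: "basic (approx n A) A \<subseteq> U" if "A \<in> R" "basic (approx n A) A \<subseteq> X" for A n
  proof
    fix C assume C: "C \<in> basic (approx n A) A"
    then have "approx n C = approx n A" "coarser C A" using basic_approx that basicD by blast+
    then have "basic (approx n C) C \<subseteq> X"
      using basic_mono[of C A "approx n C"] that(2) by simp
    then show "C \<in> U" using C that(2) by (auto simp: U_def)
  qed
  have "openin (ellentuck_topology R) U"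
    unfolding openin_ellentuck_iff
  proof (intro conjI ballI)
    show "U \<subseteq> R" using X(1) by (auto simp: U_def)
    fix A assume "A \<in> U"
    then obtain n where "A \<in> R" "basic (approx n A) A \<subseteq> X" using X(1) by (auto simp: U_def)
    then show "\<exists>n. basic (approx n A) A \<subseteq> U" using sub by blast
  qed
  moreover have "ramsey_null R (X - U)"
    unfolding ramsey_null_iff
  proof (intro ballI allI)
    fix B n assume B: "B \<in> R"
    then obtain A where A: "A \<in> basic (approx n B) B"
      "basic (approx n B) A \<subseteq> X \<or> basic (approx n B) A \<inter> X = {}"
      using X(2) unfolding ramsey_iff by blast
    have "approx n A = approx n B" "A \<in> R" using basic_approx[OF A(1) B] basicD(1)[OF A(1)] by auto
    then have "basic (approx n B) A \<inter> (X - U) = {}" using A(2) sub[of A n] by auto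
    then show "\<exists>A\<in>basic (approx n B) B. basic (approx n B) A \<inter> (X - U) = {}" using A(1) by blast
  qed
  moreover have "X = sym_diff U (X - U)" by (auto simp: U_def)
  ultimately show ?thesis
    using meagre_iff_ramsey_null[of "X - U"] X(1) unfolding has_baire_property_in_def by blast
qed

theorem topological_ramsey_space: "topological_ramsey_space R"
  unfolding topological_ramsey_space_def
  using baire_imp_ramsey ramsey_imp_baire meagre_iff_ramsey_null by blast

end

section \<open>Equivalence relations as retractions\<close>

definition regressive_retraction :: "(nat \<Rightarrow> nat) \<Rightarrow> bool" where
  "regressive_retraction f \<longleftrightarrow> (\<forall>x. f x \<le> x \<and> f (f x) = f x)"

definition fibre_rel :: "(nat \<Rightarrow> nat) \<Rightarrow> nat rel" where
  "fibre_rel f = {(x, y). f x = f y}"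

definition class_rep :: "nat rel \<Rightarrow> nat \<Rightarrow> nat" where
  "class_rep E x = (LEAST y. (x, y) \<in> E)"

definition fixpoints :: "(nat \<Rightarrow> nat) \<Rightarrow> nat set" where
  "fixpoints f = {x. f x = x}"

text \<open>At a fixpoint this is its index in the increasing enumeration of class minima. The
  counting form depends only on values below \<open>x\<close>, so it passes between functions that
  agree there.\<close>

definition fixrank :: "(nat \<Rightarrow> nat) \<Rightarrow> nat \<Rightarrow> nat" where
  "fixrank f x = card {y. y < x \<and> f y = y}"

lemma retraction_le: "regressive_retraction f \<Longrightarrow> f x \<le> x"
  and retraction_idem: "regressive_retraction f \<Longrightarrow> f (f x) = f x"
  by (simp_all add: regressive_retraction_def)

lemma in_fibre_rel_iff: "(x, y) \<in> fibre_rel f \<longleftrightarrow> f x = f y"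
  by (simp add: fibre_rel_def)

lemma equiv_fibre_rel: "equiv UNIV (fibre_rel f)"
  by (auto simp: fibre_rel_def equiv_def refl_on_def sym_def trans_def)

lemma fibre_rel_Image: "fibre_rel f `` {x} = {y. f y = f x}"
  by (auto simp: fibre_rel_def)

lemma Least_class:
  assumes "regressive_retraction f"
  shows "(LEAST y. f y = f x) = f x"
  by (rule Least_equality) (use assms in \<open>auto simp: regressive_retraction_def, metis\<close>)

lemma fibre_rel_quotient: "UNIV // fibre_rel f = (\<lambda>x. {y. f y = f x}) ` UNIV"
  by (auto simp: quotient_def fibre_rel_Image)

lemma fibre_rel_class_rep:
  assumes "equiv UNIV E"
  shows "fibre_rel (class_rep E) = E" "regressive_retraction (class_rep E)"
proof -
  have E: "(x, x) \<in> E" "(x, y) \<in> E \<Longrightarrow> (y, x) \<in> E" "(x, y) \<in> E \<Longrightarrow> (y, z) \<in> E \<Longrightarrow> (x, z) \<in> E" for x y z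
    using assms by (auto simp: equiv_def refl_on_def dest: symD transD)
  have rep: "(x, class_rep E x) \<in> E" for x
    unfolding class_rep_def by (rule LeastI[of _ x]) (rule E)
  have cong: "class_rep E x = class_rep E y" if "(x, y) \<in> E" for x y
  proof -
    have "(x, z) \<in> E \<longleftrightarrow> (y, z) \<in> E" for z using that E by blast
    then show ?thesis by (simp add: class_rep_def)
  qed
  have "class_rep E x \<le> x" for x unfolding class_rep_def by (rule Least_le) (rule E)
  then show "regressive_retraction (class_rep E)"
    using cong[OF rep] by (simp add: regressive_retraction_def)
  show "fibre_rel (class_rep E) = E"
  proof (intro set_eqI, clarify)
    fix x y
    have "(x, y) \<in> E" if "class_rep E x = class_rep E y"
      using rep[of x] rep[of y] that E(2,3) by metis
    then show "(x, y) \<in> fibre_rel (class_rep E) \<longleftrightarrow> (x, y) \<in> E" using cong by (auto simp: fibre_rel_def)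
  qed
qed

lemma fixpoints_eq_range: "regressive_retraction f \<Longrightarrow> fixpoints f = range f"
  unfolding fixpoints_def by (auto simp: retraction_idem) (metis rangeI)

lemma class_minima_fibre_rel:
  assumes "regressive_retraction f"
  shows "class_minima (fibre_rel f) = fixpoints f"
proof -
  have "class_minima (fibre_rel f) = (\<lambda>X. LEAST x. x \<in> X) ` (UNIV // fibre_rel f)"
    by (auto simp: class_minima_def)
  also have "\<dots> = range f"
    unfolding fibre_rel_quotient image_image by (simp add: Least_class[OF assms])
  finally show ?thesis using fixpoints_eq_range[OF assms] by simp
qed

lemma infinite_quotient_fibre_rel:
  assumes "regressive_retraction f"
  shows "infinite (UNIV // fibre_rel f) \<longleftrightarrow> infinite (fixpoints f)"
proof -
  have "UNIV // fibre_rel f = (\<lambda>z. {y. f y = z}) ` fixpoints f"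
    unfolding fibre_rel_quotient fixpoints_eq_range[OF assms] by (simp add: image_image)
  moreover have "inj_on (\<lambda>z. {y. f y = z}) (fixpoints f)"
    by (rule inj_onI) (auto simp: fixpoints_def)
  ultimately show ?thesis by (simp add: finite_image_iff)
qed

lemma coarser_fibre_rel_iff:
  assumes "regressive_retraction g"
  shows "coarser (fibre_rel f) (fibre_rel g) \<longleftrightarrow> (\<forall>x. f (g x) = f x)"
proof
  assume c: "coarser (fibre_rel f) (fibre_rel g)"
  show "\<forall>x. f (g x) = f x"
  proof
    fix x
    obtain \<C> where C: "\<C> \<subseteq> UNIV // fibre_rel g" "{y. f y = f x} = \<Union>\<C>"
      using c unfolding coarser_def fibre_rel_quotient by blast
    then obtain Y where Y: "Y \<in> \<C>" "x \<in> Y" by blast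
    then obtain z where "Y = {y. g y = g z}" using C(1) unfolding fibre_rel_quotient by blast
    then have "g x \<in> Y" using Y(2) retraction_idem[OF assms] by simp
    then have "g x \<in> {y. f y = f x}" using C(2) Y(1) by blast
    then show "f (g x) = f x" by simp
  qed
next
  assume fg: "\<forall>x. f (g x) = f x"
  show "coarser (fibre_rel f) (fibre_rel g)"
    unfolding coarser_def fibre_rel_quotient
  proof
    fix X assume "X \<in> range (\<lambda>x. {y. f y = f x})"
    then obtain x where X: "X = {y. f y = f x}" by blast
    have "{z. g z = g y} \<subseteq> X" if "y \<in> X" for y
    proof
      fix z assume "z \<in> {z. g z = g y}"
      then have "f z = f y" using fg by (metis mem_Collect_eq)
      then show "z \<in> X" using that X by simp
    qed
    then have "X = \<Union>((\<lambda>y. {z. g z = g y}) ` X)" by blast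
    then show "\<exists>\<C>\<subseteq>range (\<lambda>x. {y. g y = g x}). X = \<Union>\<C>"
      by (intro exI[of _ "(\<lambda>y. {z. g z = g y}) ` X"]) blast
  qed
qed

section \<open>Ranks of minima and finite approximations\<close>

lemma enumerate_eq_iff:
  fixes S :: "nat set"
  assumes "infinite S"
  shows "enumerate S k = x \<longleftrightarrow> x \<in> S \<and> card {y \<in> S. y < x} = k"
proof -
  have card: "card {y \<in> S. y < enumerate S j} = j" for j
  proof -
    have "{y \<in> S. y < enumerate S j} = enumerate S ` {..<j}"
    proof (intro set_eqI iffI)
      fix y assume "y \<in> {y \<in> S. y < enumerate S j}"
      moreover then obtain i where "enumerate S i = y" using enumerate_Ex[OF assms] by blast
      ultimately show "y \<in> enumerate S ` {..<j}" using enumerate_mono_iff[OF assms] by auto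
    next
      fix y assume "y \<in> enumerate S ` {..<j}"
      then show "y \<in> {y \<in> S. y < enumerate S j}"
        using enumerate_mono_iff[OF assms] enumerate_in_set[OF assms] by auto
    qed
    moreover have "inj_on (enumerate S) {..<j}"
      using inj_enumerate[OF assms] by (rule inj_on_subset) (rule subset_UNIV)
    ultimately show ?thesis by (simp add: card_image)
  qed
  show ?thesis
  proof
    assume "x \<in> S \<and> card {y \<in> S. y < x} = k"
    moreover then obtain j where "enumerate S j = x" using enumerate_Ex[OF assms] by blast
    ultimately show "enumerate S k = x" using card[of j] by auto
  qed (use card enumerate_in_set[OF assms] in auto)
qed

lemma class_min_fibre_rel_iff:
  assumes "regressive_retraction f" "infinite (fixpoints f)"
  shows "class_min k (fibre_rel f) = x \<longleftrightarrow> f x = x \<and> fixrank f x = k"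
proof -
  have "{y \<in> fixpoints f. y < x} = {y. y < x \<and> f y = y}" by (auto simp: fixpoints_def)
  then show ?thesis
    unfolding class_min_def class_minima_fibre_rel[OF assms(1)] enumerate_eq_iff[OF assms(2)] fixrank_def
    by (simp add: fixpoints_def)
qed

text \<open>The diagonal of an approximation recovers its segment, and the minimum of a class met by
  the segment lies in the segment, so the approximation recovers the retraction there.\<close>

lemma approx_fibre_rel_eq_iff:
  assumes "regressive_retraction f" "regressive_retraction g"
  shows "approx n (fibre_rel f) = approx m (fibre_rel g) \<longleftrightarrow>
    class_min n (fibre_rel f) = class_min m (fibre_rel g) \<and> (\<forall>x<class_min n (fibre_rel f). f x = g x)"
    (is "?L \<longleftrightarrow> ?R")
proof
  let ?p = "class_min n (fibre_rel f)" and ?q = "class_min m (fibre_rel g)"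
  assume L: ?L
  have eq: "x < ?p \<and> y < ?p \<and> f x = f y \<longleftrightarrow> x < ?q \<and> y < ?q \<and> g x = g y" for x y
  proof -
    have "(x, y) \<in> approx n (fibre_rel f) \<longleftrightarrow> (x, y) \<in> approx m (fibre_rel g)" using L by simp
    then show ?thesis by (auto simp: approx_def in_fibre_rel_iff)
  qed
  have "x < ?p \<longleftrightarrow> x < ?q" for x using eq[of x x] by simp
  then have pq: "?p = ?q" by (metis linorder_neqE_nat less_irrefl)
  have agree: "f x = g x" if x: "x < ?p" for x
  proof (rule antisym)
    have fx: "f x < ?p" and gx: "g x < ?p"
      using x retraction_le[OF assms(1), of x] retraction_le[OF assms(2), of x] by linarith+
    \<comment> \<open>The pair of \<open>x\<close> and its minimum \<open>f x\<close> belongs to the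
      common restriction; regressiveness then gives \<open>g x \<le> f x\<close>, and symmetrically
      for the other inequality.\<close>
    have "g x = g (f x)"
      using eq[of x "f x"] x fx retraction_idem[OF assms(1), of x] by simp
    moreover have "f x = f (g x)"
      using eq[of x "g x"] x gx pq retraction_idem[OF assms(2), of x] by simp
    ultimately show "f x \<le> g x" "g x \<le> f x"
      using retraction_le[OF assms(1), of "g x"] retraction_le[OF assms(2), of "f x"] by simp_all
  qed
  show ?R using pq agree by (intro conjI allI impI)
next
  assume R: ?R
  have "(x, y) \<in> approx n (fibre_rel f) \<longleftrightarrow> (x, y) \<in> approx m (fibre_rel g)" for x y
    using R by (auto simp: approx_def in_fibre_rel_iff)
  then show ?L by auto
qed

lemma rank_cong: "(\<And>y. y < x \<Longrightarrow> f y = g y) \<Longrightarrow> fixrank f x = fixrank g x"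
  unfolding fixrank_def by (metis (no_types, lifting))

lemma rank_split:
  assumes "q \<le> x"
  shows "fixrank f x = fixrank f q + card {y. q \<le> y \<and> y < x \<and> f y = y}"
proof -
  have "{y. y < x \<and> f y = y} = {y. y < q \<and> f y = y} \<union> {y. q \<le> y \<and> y < x \<and> f y = y}"
    using assms by auto
  moreover have "card \<dots> = fixrank f q + card {y. q \<le> y \<and> y < x \<and> f y = y}"
    unfolding fixrank_def by (rule card_Un_disjoint) auto
  ultimately show ?thesis by (simp add: fixrank_def)
qed

text \<open>The chain \<open>x = f x = f (g x) \<le> g x \<le> x\<close> collapses.\<close>

lemma fixpoint_of_coarser:
  assumes "regressive_retraction f" "regressive_retraction g" "\<And>x. f (g x) = f x" "f x = x"
  shows "g x = x"
  using retraction_le[OF assms(1), of "g x"] retraction_le[OF assms(2), of x] assms(3)[of x] assms(4)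
  by simp

section \<open>Retractions respecting the partition\<close>

locale typed_partition =
  fixes l :: nat and P :: "nat \<Rightarrow> nat set"
  assumes l_pos: "l \<ge> 1"
    and cover: "(\<Union>i<l. P i) = UNIV"
    and disjoint: "disjoint_family_on P {..<l}"
begin

definition part :: "nat \<Rightarrow> nat" where
  "part x = (THE i. i < l \<and> x \<in> P i)"

lemma part_eq_iff: "i < l \<Longrightarrow> part x = i \<longleftrightarrow> x \<in> P i"
  and part_less: "part x < l"
proof -
  obtain j where j: "j < l" "x \<in> P j" using cover by blast
  have uniq: "i = j" if "i < l" "x \<in> P i" for i
    using disjoint that j unfolding disjoint_family_on_def by blast
  have eq: "part x = j"
    unfolding part_def by (rule the_equality) (use j in \<open>blast intro: uniq\<close>)+
  then show "part x < l" using j(1) by simp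
  show "part x = i \<longleftrightarrow> x \<in> P i" if "i < l"
  proof
    assume "part x = i"
    then show "x \<in> P i" using eq j(2) by simp
  next
    assume "x \<in> P i"
    then show "part x = i" using uniq[OF that] eq by simp
  qed
qed

text \<open>As \<open>f x\<close> is the minimum of the class of \<open>x\<close>, the last clause
  is condition (c) read pointwise; the clause before it is (b).\<close>

definition admissible :: "(nat \<Rightarrow> nat) \<Rightarrow> bool" where
  "admissible f \<longleftrightarrow> regressive_retraction f \<and> infinite (fixpoints f) \<and>
     (\<forall>x. f x = x \<longrightarrow> part x = fixrank f x mod l) \<and> (\<forall>x. part (f x) \<le> part x)"

lemma fibre_rel_in_E_inf_iff:
  assumes f: "regressive_retraction f"
  shows "fibre_rel f \<in> E_inf l P \<longleftrightarrow> admissible f"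
proof -
  have 1: "(\<forall>k. class_min k (fibre_rel f) \<in> P (k mod l)) \<longleftrightarrow> (\<forall>x. f x = x \<longrightarrow> part x = fixrank f x mod l)"
    if inf: "infinite (fixpoints f)"
  proof -
    have part: "x \<in> P (k mod l) \<longleftrightarrow> part x = k mod l" for x k
      using part_eq_iff[of "k mod l" x] l_pos by simp
    show ?thesis
      unfolding part using class_min_fibre_rel_iff[OF f inf] by metis
  qed
  have 2: "(\<forall>n<l. \<forall>X\<in>UNIV // fibre_rel f. (LEAST x. x \<in> X) \<in> P n \<longrightarrow> X \<subseteq> (\<Union>m\<in>{n..<l}. P m)) \<longleftrightarrow>
      (\<forall>x. part (f x) \<le> part x)" (is "?L \<longleftrightarrow> ?R")
  proof -
    have mem: "y \<in> (\<Union>m\<in>{n..<l}. P m) \<longleftrightarrow> n \<le> part y" for n y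
    proof
      assume "y \<in> (\<Union>m\<in>{n..<l}. P m)"
      then obtain m where "n \<le> m" "m < l" "y \<in> P m" by auto
      then show "n \<le> part y" using part_eq_iff[of m y] by simp
    next
      assume "n \<le> part y"
      then show "y \<in> (\<Union>m\<in>{n..<l}. P m)"
        using part_less[of y] part_eq_iff[of "part y" y] by auto
    qed
    have "?L \<longleftrightarrow> (\<forall>n<l. \<forall>x. f x \<in> P n \<longrightarrow> {y. f y = f x} \<subseteq> (\<Union>m\<in>{n..<l}. P m))"
      unfolding fibre_rel_quotient by (simp add: Least_class[OF f])
    also have "\<dots> \<longleftrightarrow> (\<forall>n<l. \<forall>x. part (f x) = n \<longrightarrow> (\<forall>y. f y = f x \<longrightarrow> n \<le> part y))"
      unfolding subset_iff mem using part_eq_iff by simp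
    also have "\<dots> \<longleftrightarrow> ?R"
      using part_less by (metis order_refl)
    finally show ?thesis .
  qed
  show ?thesis
    unfolding E_inf_def admissible_def mem_Collect_eq infinite_quotient_fibre_rel[OF f] 2
    using f equiv_fibre_rel 1 by blast
qed

lemma E_infE:
  assumes "E \<in> E_inf l P"
  obtains f where "E = fibre_rel f" "admissible f"
proof -
  have "equiv UNIV E" using assms by (simp add: E_inf_def)
  note E = fibre_rel_class_rep[OF this]
  show ?thesis using that[of "class_rep E"] fibre_rel_in_E_inf_iff[OF E(2)] E assms by simp
qed

lemma admissibleD:
  assumes "admissible f"
  shows "regressive_retraction f" "infinite (fixpoints f)" "f x = x \<Longrightarrow> part x = fixrank f x mod l" "part (f x) \<le> part x"
    "f x \<le> x" "f (f x) = f x"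
  using assms by (auto simp: admissible_def regressive_retraction_def)

lemma fibre_rel_in_E_inf: "admissible f \<Longrightarrow> fibre_rel f \<in> E_inf l P"
  using fibre_rel_in_E_inf_iff admissibleD(1) by blast

lemma class_min_iff: "admissible f \<Longrightarrow> class_min k (fibre_rel f) = x \<longleftrightarrow> f x = x \<and> fixrank f x = k"
  using class_min_fibre_rel_iff admissibleD by blast

lemma class_min_fix: "admissible f \<Longrightarrow> f (class_min k (fibre_rel f)) = class_min k (fibre_rel f)"
  and rank_class_min: "admissible f \<Longrightarrow> fixrank f (class_min k (fibre_rel f)) = k"
  and class_min_rank: "admissible f \<Longrightarrow> f x = x \<Longrightarrow> class_min (fixrank f x) (fibre_rel f) = x"
  using class_min_iff by blast+

lemma class_min_le_iff:
  assumes "admissible f"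
  shows "class_min n (fibre_rel f) \<le> class_min m (fibre_rel f) \<longleftrightarrow> n \<le> m"
  unfolding class_min_def class_minima_fibre_rel[OF admissibleD(1)[OF assms]]
  by (rule enumerate_mono_le_iff[OF admissibleD(2)[OF assms]])

lemma class_min_less_iff:
  assumes "admissible f"
  shows "class_min n (fibre_rel f) < class_min m (fibre_rel f) \<longleftrightarrow> n < m"
  using class_min_le_iff[OF assms, of m n] by (simp add: not_le[symmetric])

lemma le_class_min:
  assumes "admissible f"
  shows "k \<le> class_min k (fibre_rel f)"
  unfolding class_min_def class_minima_fibre_rel[OF admissibleD(1)[OF assms]]
  by (rule le_enumerate[OF admissibleD(2)[OF assms]])

lemma part_class_min: "admissible f \<Longrightarrow> part (class_min k (fibre_rel f)) = k mod l"
  using admissibleD(3) class_min_fix rank_class_min by metis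

lemma coarser_iff: "admissible g \<Longrightarrow> coarser (fibre_rel f) (fibre_rel g) \<longleftrightarrow> (\<forall>x. f (g x) = f x)"
  using coarser_fibre_rel_iff admissibleD by blast

lemma approx_eq_iff:
  "admissible f \<Longrightarrow> admissible g \<Longrightarrow> approx n (fibre_rel f) = approx m (fibre_rel g) \<longleftrightarrow>
    class_min n (fibre_rel f) = class_min m (fibre_rel g) \<and> (\<forall>x<class_min n (fibre_rel f). f x = g x)"
  using approx_fibre_rel_eq_iff admissibleD by blast

lemma fix_coarser: "admissible f \<Longrightarrow> admissible g \<Longrightarrow> \<forall>x. f (g x) = f x \<Longrightarrow> f x = x \<Longrightarrow> g x = x"
  using fixpoint_of_coarser admissibleD(1) by metis

text \<open>The length of an approximation is the number of fixpoints below its end, which the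
  restriction determines.\<close>

lemma approx_eq_imp_eq:
  assumes "admissible f" "admissible g" "approx n (fibre_rel f) = approx m (fibre_rel g)"
  shows "n = m"
proof -
  let ?x = "class_min n (fibre_rel f)"
  have eq: "?x = class_min m (fibre_rel g)" "\<forall>y<?x. f y = g y"
    using assms(3) approx_eq_iff[OF assms(1,2)] by auto
  have "n = fixrank f ?x" using rank_class_min[OF assms(1)] by simp
  also have "\<dots> = fixrank g ?x" using eq(2) by (intro rank_cong) blast
  also have "\<dots> = m" using eq(1) rank_class_min[OF assms(2)] by simp
  finally show ?thesis .
qed

lemma approx_eq_mono:
  assumes f: "admissible f" and g: "admissible g" and eq: "approx n (fibre_rel f) = approx n (fibre_rel g)"
    and "k \<le> n"
  shows "approx k (fibre_rel f) = approx k (fibre_rel g)"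
proof (cases "k = n")
  case False
  let ?x = "class_min k (fibre_rel f)" and ?p = "class_min n (fibre_rel f)"
  have agree: "\<forall>y<?p. f y = g y" using eq approx_eq_iff[OF f g] by blast
  have less: "?x < ?p" using class_min_less_iff[OF f] False \<open>k \<le> n\<close> by simp
  have "g ?x = ?x" using agree less class_min_fix[OF f, of k] by simp
  moreover have "fixrank g ?x = fixrank f ?x" using agree less by (intro rank_cong) simp
  ultimately have "class_min k (fibre_rel g) = ?x"
    using class_min_iff[OF g] rank_class_min[OF f] by simp
  then show ?thesis using approx_eq_iff[OF f g] agree less by auto
qed (use eq in simp)

text \<open>The witness \<open>h\<close> keeps the classes of \<open>g\<close> that begin below the
  common minimum \<open>q\<close> and merges all later ones as \<open>f\<close> does. A relation
  below \<open>h\<close> that starts like \<open>f\<close> also merges the early classes as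
  \<open>f\<close> does, hence lies below \<open>f\<close>.\<close>

lemma fibre_rel_amalgamation:
  assumes f: "admissible f" and g: "admissible g" and fg: "\<forall>x. f (g x) = f x"
    and q: "class_min n (fibre_rel f) = class_min m (fibre_rel g)"
  shows "\<exists>C\<in>E_inf l P. coarser C (fibre_rel g) \<and> approx m C = approx m (fibre_rel g) \<and>
     basic_set (E_inf l P) (approx n (fibre_rel f)) C \<subseteq> basic_set (E_inf l P) (approx n (fibre_rel f)) (fibre_rel f)"
proof -
  define q where "q = class_min n (fibre_rel f)"
  have fq: "f q = q" "fixrank f q = n"
    using class_min_iff[OF f, of n q] by (simp_all add: q_def)
  have gq: "g q = q" "fixrank g q = m"
    using class_min_iff[OF g, of m q] assms(4) by (simp_all add: q_def)
  note fD = admissibleD[OF f] and gD = admissibleD[OF g]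
  have fixg: "g x = x" if "f x = x" for x using fix_coarser[OF f g fg that] .
  define h where "h x = (if g x < q then g x else f x)" for x
  have h_le: "h x \<le> x" for x by (simp add: h_def fD gD)
  have h_idem: "h (h x) = h x" for x
  proof (cases "g x < q")
    case True
    then show ?thesis by (simp add: h_def gD)
  next
    case False
    have "g (f x) = f x" by (rule fixg) (rule fD)
    then show ?thesis using False by (simp add: h_def fD)
  qed
  have h_fix: "h x = x \<longleftrightarrow> (if x < q then g x = x else f x = x)" for x
    using fixg[of x] gD(5)[of x] by (auto simp: h_def)
  have retr: "regressive_retraction h" using h_le h_idem by (simp add: regressive_retraction_def)
  have inf: "infinite (fixpoints h)"
  proof
    assume "finite (fixpoints h)"
    then have "finite (fixpoints h \<union> {..<q})" by simp
    moreover have "fixpoints f \<subseteq> fixpoints h \<union> {..<q}" using h_fix by (auto simp: fixpoints_def)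
    ultimately show False using fD(2) finite_subset by blast
  qed
  have rank_below: "fixrank h x = fixrank g x" if "x \<le> q" for x
  proof -
    have "{y. y < x \<and> h y = y} = {y. y < x \<and> g y = y}" using h_fix that by auto
    then show ?thesis by (simp add: fixrank_def)
  qed
  have rank_above: "fixrank h x + n = fixrank f x + m" if "q \<le> x" for x
  proof -
    have "{y. q \<le> y \<and> y < x \<and> h y = y} = {y. q \<le> y \<and> y < x \<and> f y = y}" using h_fix by auto
    then show ?thesis
      using rank_split[OF that, of h] rank_split[OF that, of f] rank_below[of q] fq gq by simp
  qed
  have nm: "[n = m] (mod l)"
    using fD(3)[OF fq(1)] gD(3)[OF gq(1)] fq gq by (simp add: cong_def)
  have adm: "admissible h"
    unfolding admissible_def
  proof (intro conjI allI impI)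
    fix x assume x: "h x = x"
    show "part x = fixrank h x mod l"
    proof (cases "x < q")
      case True
      then show ?thesis using x h_fix gD(3) rank_below[of x] by simp
    next
      case False
      then have "[fixrank h x + n = fixrank f x + m] (mod l)" using rank_above[of x] by simp
      moreover have "[fixrank f x + m = fixrank f x + n] (mod l)"
        using nm by (intro cong_add) (simp_all add: cong_sym)
      ultimately have "[fixrank h x = fixrank f x] (mod l)"
        using cong_trans cong_add_rcancel_nat by blast
      then show ?thesis using False x h_fix fD(3) by (simp add: cong_def)
    qed
  next
    fix x show "part (h x) \<le> part x" by (simp add: h_def fD(4) gD(4))
  qed (use retr inf in auto)
  have hg: "\<forall>x. h (g x) = h x" using fg by (simp add: h_def gD)
  have hq: "class_min m (fibre_rel h) = q"
    unfolding class_min_iff[OF adm] using h_fix fq gq rank_below[of q] by simp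
  have below: "h x = g x" if "x < q" for x using gD(5)[of x] that by (simp add: h_def)
  have "approx m (fibre_rel h) = approx m (fibre_rel g)"
    unfolding approx_eq_iff[OF adm g] using hq below q by (simp add: q_def)
  moreover have "basic_set (E_inf l P) (approx n (fibre_rel f)) (fibre_rel h)
      \<subseteq> basic_set (E_inf l P) (approx n (fibre_rel f)) (fibre_rel f)"
  proof
    fix K assume K: "K \<in> basic_set (E_inf l P) (approx n (fibre_rel f)) (fibre_rel h)"
    then obtain k where k: "K = fibre_rel k" "admissible k"
      unfolding basic_set_def by (blast elim: E_infE)
    obtain i where i: "approx i K = approx n (fibre_rel f)" using K by (auto simp: basic_set_def)
    then have "i = n" using approx_eq_imp_eq[OF k(2) f] k(1) by simp
    then have kf: "\<forall>x<q. k x = f x" 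
      using i approx_eq_iff[OF k(2) f] k(1) by (simp add: q_def)
    have kh: "\<forall>x. k (h x) = k x" using K coarser_iff[OF adm] k by (simp add: basic_set_def)
    have "k (f x) = k x" for x
    proof (cases "g x < q")
      case True
      then have "k x = f (g x)" using kh[rule_format, of x] kf by (simp add: h_def)
      then have 1: "k x = f x" using fg by simp
      have "f x < q" using fg fD(5)[of "g x"] True by (metis le_less_trans)
      then show ?thesis using kf 1 by (simp add: fD)
    next
      case False
      then show ?thesis using kh[rule_format, of x] by (simp add: h_def)
    qed
    then have "coarser K (fibre_rel f)" using coarser_iff[OF f] k by simp
    then show "K \<in> basic_set (E_inf l P) (approx n (fibre_rel f)) (fibre_rel f)"
      using K by (auto simp: basic_set_def)
  qed
  ultimately show ?thesis
    using fibre_rel_in_E_inf[OF adm] coarser_iff[OF g] hg by blast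
qed

lemma fibre_rel_fusion_limit:
  assumes f: "\<And>i. admissible (f i)" and coarser: "\<And>i x. f (Suc i) (f i x) = f (Suc i) x"
    and eq: "\<And>i. approx (n + i) (fibre_rel (f (Suc i))) = approx (n + i) (fibre_rel (f i))"
  shows "\<exists>g. admissible g \<and> (\<forall>i. (\<forall>x. g (f i x) = g x) \<and> approx (n + i) (fibre_rel g) = approx (n + i) (fibre_rel (f i)))"
proof -
  define q where "q i = class_min (n + i) (fibre_rel (f i))" for i
  note fD = admissibleD[OF f]
  have q_eq: "class_min (n + i) (fibre_rel (f (Suc i))) = q i" 
    and agree1: "x < q i \<Longrightarrow> f (Suc i) x = f i x" for i x
    using eq[of i] approx_eq_iff[OF f f] by (auto simp: q_def)
  have "q i \<le> q (Suc i)" for i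
    using class_min_le_iff[OF f, of "n + i" "Suc i" "n + Suc i"] q_eq by (simp add: q_def)
  then have q_mono: "i \<le> j \<Longrightarrow> q i \<le> q j" for i j by (rule lift_Suc_mono_le)
  have q_ge: "i \<le> q i" for i using le_class_min[OF f, of "n + i" i] by (simp add: q_def)
  have agree: "f j x = f i x" if "i \<le> j" "x < q i" for i j x
    using that
  proof (induction j rule: dec_induct)
    case (step j)
    then show ?case using agree1[of x j] q_mono[of i j] by simp
  qed simp
  have comp: "f j (f i x) = f j x" if "i \<le> j" for i j x
    using that
  proof (induction j rule: dec_induct)
    case base
    then show ?case by (rule fD)
  next
    case (step j)
    then show ?case using coarser[of j] by metis
  qed
  define g where "g x = f (Suc x) x" for x
  have g_eq: "g x = f j x" if "x < j" for x j
    using agree[of "Suc x" j x] q_ge[of "Suc x"] that by (simp add: g_def)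
  have gq: "g x = f i x" if "x < q i" for i x
    using g_eq[of x "max i (Suc x)"] agree[of i "max i (Suc x)" x] that by simp
  have retr: "regressive_retraction g"
    unfolding regressive_retraction_def
  proof (intro allI conjI)
    fix x
    show le: "g x \<le> x" by (simp add: g_def fD)
    have "g (g x) = f (Suc x) (g x)" by (rule g_eq) (use le in simp)
    also have "\<dots> = g x" by (simp add: g_def fD)
    finally show "g (g x) = g x" .
  qed
  have fixq: "g (q i) = q i" and rankq: "fixrank g (q i) = n + i" for i
  proof -
    \<comment> \<open>Agreement with \<open>f i\<close> is known only strictly below
      \<open>q i\<close>. That \<open>q i\<close> itself is fixed is read off a stage beyond
      \<open>q i\<close>, where it is still the minimum of index \<open>n + i\<close>.\<close>
    let ?j = "max i (Suc (q i))"
    have "class_min (n + i) (fibre_rel (f j)) = q i" if "i \<le> j" for j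
      using that
    proof (induction j rule: dec_induct)
      case (step j)
      have "approx (n + i) (fibre_rel (f (Suc j))) = approx (n + i) (fibre_rel (f j))"
        using approx_eq_mono[OF f f eq[of j]] step by simp
      then show ?case using step approx_eq_iff[OF f f] by metis
    qed (simp add: q_def)
    then have "f ?j (q i) = q i" using class_min_fix[OF f, of ?j "n + i"] by simp
    then show "g (q i) = q i" using g_eq[of "q i" ?j] by simp
    have "fixrank g (q i) = fixrank (f i) (q i)" by (rule rank_cong) (rule gq)
    then show "fixrank g (q i) = n + i" using rank_class_min[OF f, of i "n + i"] by (simp add: q_def)
  qed
  have inf: "infinite (fixpoints g)"
    unfolding infinite_nat_iff_unbounded_le using fixq q_ge by (auto simp: fixpoints_def)
  have adm: "admissible g"
    unfolding admissible_def
  proof (intro conjI allI impI)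
    fix x assume x: "g x = x"
    have "fixrank g x = fixrank (f (Suc x)) x" by (rule rank_cong) (rule g_eq, simp)
    then show "part x = fixrank g x mod l" using fD(3)[of "Suc x" x] x by (simp add: g_def)
  next
    fix x show "part (g x) \<le> part x" by (simp add: g_def fD(4))
  qed (use retr inf in auto)
  have "g (f i x) = g x" for i x
  proof -
    let ?j = "max i (Suc x)"
    have "f i x < ?j" using fD(5)[of i x] by simp
    then show ?thesis using g_eq[of "f i x" ?j] g_eq[of x ?j] comp[of i ?j x] by simp
  qed
  moreover have "approx (n + i) (fibre_rel g) = approx (n + i) (fibre_rel (f i))" for i
  proof -
    have "class_min (n + i) (fibre_rel g) = q i" using class_min_iff[OF adm] fixq rankq by blast
    then show ?thesis unfolding approx_eq_iff[OF adm f] using gq by (simp add: q_def)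
  qed
  ultimately show ?thesis using adm by blast
qed

end

text \<open>With \<open>D\<close> the surviving blocks, this counts the surviving classes before a
  given position: full blocks contribute multiples of \<open>l\<close>, so the position inside a
  surviving block fixes the rank modulo \<open>l\<close>.\<close>

lemma dvd_card_blocks:
  fixes l :: nat
  assumes "j < l"
  shows "l dvd card {i. i < l * s \<and> i div l \<in> D}"
    and "s \<in> D \<Longrightarrow> card {i. i < l * s + j \<and> i div l \<in> D} = card {i. i < l * s \<and> i div l \<in> D} + j"
proof -
  have block: "card {i. i < l * s + j \<and> i div l \<in> D} = card {i. i < l * s \<and> i div l \<in> D} + (if s \<in> D then j else 0)"
    if "j \<le> l" for j s
  proof -
    have "{i. i < l * s + j \<and> i div l \<in> D} =
        {i. i < l * s \<and> i div l \<in> D} \<union> (if s \<in> D then {l * s..<l * s + j} else {})" (is "?A = ?B")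
    proof (intro set_eqI)
      fix i
      have "i div l = s" if "l * s \<le> i" "i < l * s + j"
        using that \<open>j \<le> l\<close> by (intro div_nat_eqI) (auto simp: mult.commute)
      then show "i \<in> ?A \<longleftrightarrow> i \<in> ?B" by (cases "i < l * s") auto
    qed
    moreover have "card ?B = card {i. i < l * s \<and> i div l \<in> D} + (if s \<in> D then j else 0)"
      by (subst card_Un_disjoint) auto
    ultimately show ?thesis by simp
  qed
  show "l dvd card {i. i < l * s \<and> i div l \<in> D}"
  proof (induction s)
    case (Suc s)
    then show ?case using block[of l s] by (simp add: add.commute)
  qed simp
  show "card {i. i < l * s + j \<and> i div l \<in> D} = card {i. i < l * s \<and> i div l \<in> D} + j" if "s \<in> D"
    using block[of j s] that assms by simp
qed

section \<open>The pigeonhole principle for one-step extensions\<close>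

context typed_partition
begin

text \<open>The classes of \<open>g\<close> beyond the \<open>n\<close>-th are read in blocks of \<open>l\<close>. A one-step extension of
  \<open>approx n g\<close> below \<open>g\<close> is a word whose letters describe, for one block, into which of the first
  \<open>n + 1\<close> classes its members are merged; a variable opens \<open>l\<close> new classes.\<close>

lemma fibre_rel_pigeonhole:
  assumes g: "admissible g"
  shows "\<exists>f. admissible f \<and> (\<forall>x. f (g x) = f x) \<and> approx n (fibre_rel f) = approx n (fibre_rel g) \<and>
    (\<exists>b. \<forall>h. admissible h \<longrightarrow> (\<forall>x. h (f x) = h x) \<longrightarrow> approx n (fibre_rel h) = approx n (fibre_rel g) \<longrightarrow>
       (approx (Suc n) (fibre_rel h) \<in> \<O>) = b)"
proof -
  note gD = admissibleD[OF g]
  have l0: "l > 0" using l_pos by simp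
  \<comment> \<open>\<open>q 0\<close> is the end of \<open>approx n g\<close> and remains a minimum
    in every extension; the blocks start at \<open>q 1\<close>.\<close>
  define q where "q k = class_min (n + k) (fibre_rel g)" for k
  have q_fix: "g (q k) = q k" and q_rank: "fixrank g (q k) = n + k" and q_part: "part (q k) = (n + k) mod l" for k
    unfolding q_def using class_min_fix[OF g] rank_class_min[OF g] part_class_min[OF g] by blast+
  have q_less: "q i < q j \<longleftrightarrow> i < j" and q_le: "q i \<le> q j \<longleftrightarrow> i \<le> j" for i j
    using class_min_less_iff[OF g] class_min_le_iff[OF g] by (simp_all add: q_def)
  have q_eq: "q i = q j \<longleftrightarrow> i = j" for i j using q_le by (metis order_antisym order_refl)
  have q_ex: "\<exists>k. x = q k" if "g x = x" "q 0 \<le> x" for x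
  proof -
    have "fixrank g x \<ge> n"
      using class_min_le_iff[OF g, of n "fixrank g x"] class_min_rank[OF g that(1)] that(2)
      by (simp add: q_def)
    then have "x = q (fixrank g x - n)" using class_min_rank[OF g that(1)] by (simp add: q_def)
    then show ?thesis by blast
  qed
  define idx where "idx z = fixrank g z - n" for z
  have idx_q: "idx (q k) = k" for k by (simp add: idx_def q_rank)
  define ext where "ext V x = (if g x \<le> q 0 then g x else V (idx (g x)))" for V :: "nat \<Rightarrow> nat" and x
  \<comment> \<open>The bound \<open>z \<le> q 0\<close> includes \<open>q 0\<close>, giving
    \<open>n + 1\<close> possible targets. Position \<open>j\<close> of any block has index
    \<open>n + 1 + j\<close> modulo \<open>l\<close>, so legality does not depend on the
    block.\<close>
  define \<Lambda> where "\<Lambda> = PiE {..<l} (\<lambda>j. {z. g z = z \<and> z \<le> q 0 \<and> part z \<le> (n + 1 + j) mod l})"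
  have "finite \<Lambda>"
    unfolding \<Lambda>_def by (intro finite_PiE) (auto intro: finite_subset[of _ "{..q 0}"])
  have g0: "g 0 = 0" using gD(5)[of 0] by simp
  have part0: "part 0 = 0" using gD(3)[OF g0] by (simp add: fixrank_def)
  \<comment> \<open>The point 0 is a minimum in part 0, so its class may absorb any other; this
    letter also serves as a default below.\<close>
  have "(\<lambda>j\<in>{..<l}. 0) \<in> \<Lambda>" using g0 part0 by (auto simp: \<Lambda>_def)
  then have "\<Lambda> \<noteq> {}" by blast
  have \<Lambda>D: "g (a j) = a j" "a j \<le> q 0" "part (a j) \<le> (n + 1 + j) mod l" if "a \<in> \<Lambda>" "j < l" for a j
    using PiE_mem[OF that(1)[unfolded \<Lambda>_def], of j] that(2) by simp_all
  define letter where "letter W k = (W ! ((k - 1) div l)) ((k - 1) mod l)" for W :: "(nat \<Rightarrow> nat) list" and k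
  \<comment> \<open>The approximation coded by \<open>W\<close>: \<open>M\<close> is the first
    minimum after the blocks that \<open>W\<close> describes, hence the next minimum of the
    extension.\<close>
  define wrel where "wrel W = (let M = q (1 + l * length W) in
      {(x, y). x < M \<and> y < M \<and> ext (letter W) x = ext (letter W) y})" for W
  obtain u :: "nat \<Rightarrow> (nat \<Rightarrow> nat) + nat" and b where
    u_letter: "\<And>i a. u i = Inl a \<Longrightarrow> a \<in> \<Lambda>" and
    u_var: "\<And>i s. u i = Inr s \<Longrightarrow> s \<le> i \<and> u s = Inr s" and
    u_inf: "infinite {s. u s = Inr s}" and
    u_mono: "\<And>s a. u s = Inr s \<Longrightarrow> (\<And>j. a j \<in> \<Lambda>) \<Longrightarrow> (wrel (fill a (map u [0..<s])) \<in> \<O>) = b"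
    by (rule carlson_simpson[OF \<open>finite \<Lambda>\<close> \<open>\<Lambda> \<noteq> {}\<close>, of "\<lambda>W. wrel W \<in> \<O>"]) blast
  define D where "D = {s. u s = Inr s}"
  \<comment> \<open>A letter sends its block to old classes; an occurrence of variable
    \<open>s\<close> sends its block, position by position, to block \<open>s\<close>, where the
    variable first occurs.\<close>
  define V where "V k = (case u ((k - 1) div l) of Inl a \<Rightarrow> a ((k - 1) mod l)
      | Inr s \<Rightarrow> q (Suc (l * s + (k - 1) mod l)))" for k
  define f where "f = ext V"
  have f_low: "f x = g x" if "g x \<le> q 0" for x using that by (simp add: f_def ext_def)
  have f_q: "f (q (Suc k)) = V (Suc k)" for k
    using q_less[of 0 "Suc k"] by (simp add: f_def ext_def q_fix idx_q)
  have fg: "f (g x) = f x" for x by (simp add: f_def ext_def gD)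
  have cases_g: "g x \<le> q 0 \<or> (\<exists>k. g x = q (Suc k))" for x
  proof (rule disjCI)
    assume "\<not> (\<exists>k. g x = q (Suc k))"
    then show "g x \<le> q 0" using q_ex[of "g x"] gD(6)[of x] by (metis not0_implies_Suc nat_le_linear)
  qed
  have V_letter: "V (Suc k) = a (k mod l) \<and> g (V (Suc k)) = V (Suc k) \<and> V (Suc k) \<le> q 0 \<and>
      part (V (Suc k)) \<le> (n + Suc k) mod l"
    if "u (k div l) = Inl a" for k a
  proof -
    have "k mod l < l" using l0 by simp
    moreover have "(n + 1 + k mod l) mod l = (n + Suc k) mod l" using mod_add_right_eq[of "Suc n" k l] by simp
    ultimately show ?thesis using \<Lambda>D[OF u_letter[OF that], of "k mod l"] that by (simp add: V_def)
  qed
  have V_var: "V (Suc k) = q (Suc (l * s + k mod l)) \<and> V (Suc k) \<le> q (Suc k) \<and>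
      f (V (Suc k)) = V (Suc k) \<and> part (V (Suc k)) = (n + Suc k) mod l"
    if "u (k div l) = Inr s" for k s
  proof -
    have s: "s \<le> k div l" "u s = Inr s" using u_var[OF that] by auto
    have V: "V (Suc k) = q (Suc (l * s + k mod l))" using that by (simp add: V_def)
    have "l * s \<le> l * (k div l)" using s(1) by (rule mult_le_mono2)
    then have le: "l * s + k mod l \<le> k" using mult_div_mod_eq[of l k] by linarith
    have "(l * s + k mod l) div l = s" using l0 by simp
    then have "f (V (Suc k)) = V (Suc k)"
      unfolding V f_q using s by (simp add: V_def)
    moreover have "(n + Suc (l * s + k mod l)) mod l = (n + Suc k) mod l"
    proof -
      have "(n + Suc (l * s + k mod l)) mod l = (n + Suc (k mod l) + l * s) mod l" by (simp add: ac_simps)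
      also have "\<dots> = (n + Suc (k mod l)) mod l" by simp
      also have "\<dots> = (n + Suc k) mod l" using mod_add_right_eq[of "Suc n" k l] by simp
      finally show ?thesis .
    qed
    ultimately show ?thesis using V le q_le q_part by simp
  qed
  have f_V: "f (V (Suc k)) = V (Suc k) \<and> V (Suc k) \<le> q (Suc k) \<and> part (V (Suc k)) \<le> part (q (Suc k))" for k
  proof (cases "u (k div l)")
    case (Inl a)
    then have "g (V (Suc k)) = V (Suc k)" "V (Suc k) \<le> q 0" "part (V (Suc k)) \<le> (n + Suc k) mod l"
      using V_letter by blast+
    moreover have "q 0 \<le> q (Suc k)" using q_le by simp
    ultimately show ?thesis using f_low[of "V (Suc k)"] q_part[of "Suc k"] by simp
  next
    case (Inr s)
    show ?thesis using V_var[OF Inr] q_part[of "Suc k"] by (metis order_refl)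
  qed
  have f_all: "f x \<le> x \<and> f (f x) = f x \<and> part (f x) \<le> part x" for x
  proof -
    consider "g x \<le> q 0" | k where "g x = q (Suc k)" using cases_g by blast
    then show ?thesis
    proof cases
      case 1
      then show ?thesis using f_low[of x] f_low[of "g x"] gD(4-6)[of x] by simp
    next
      case 2
      then have "f x = V (Suc k)" using fg[of x] f_q by simp
      then show ?thesis using f_V[of k] 2 gD(4,5)[of x] by auto
    qed
  qed
  have retr: "regressive_retraction f" using f_all by (simp add: regressive_retraction_def)
  have f_fix_q: "f (q (Suc k)) = q (Suc k) \<longleftrightarrow> k div l \<in> D" for k
  proof (cases "u (k div l)")
    case (Inl a)
    then have "V (Suc k) \<le> q 0" using V_letter by blast
    moreover have "q 0 < q (Suc k)" using q_less by simp
    ultimately show ?thesis using f_q Inl by (auto simp: D_def)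
  next
    case (Inr s)
    have "V (Suc k) = q (Suc k) \<longleftrightarrow> l * s + k mod l = k" using V_var[OF Inr] q_eq by simp
    also have "\<dots> \<longleftrightarrow> s = k div l"
    proof -
      have "k = l * (k div l) + k mod l" by simp
      then show ?thesis using l0 by (metis add_right_cancel mult_left_cancel neq0_conv)
    qed
    finally show ?thesis using f_q Inr by (auto simp: D_def)
  qed
  have f_fix_ge: "f x = x \<and> q 0 < x \<longleftrightarrow> (\<exists>k. x = q (Suc k) \<and> k div l \<in> D)" for x
  proof
    assume x: "f x = x \<and> q 0 < x"
    have gx: "g x = x" using fixpoint_of_coarser[OF retr gD(1) fg] x by blast
    then obtain k where "x = q (Suc k)" using cases_g[of x] x by auto
    then show "\<exists>k. x = q (Suc k) \<and> k div l \<in> D" using f_fix_q x by blast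
  qed (use f_fix_q q_less in auto)
  have f_rank_low: "fixrank f x = fixrank g x" if "x \<le> q 0" for x
    by (rule rank_cong) (use f_low gD(5) that in \<open>meson le_trans less_imp_le\<close>)
  have f_q0: "f (q 0) = q 0" using f_low[of "q 0"] q_fix by simp
  \<comment> \<open>The summand \<open>Suc n\<close> counts the \<open>n\<close> minima below
    \<open>q 0\<close> and \<open>q 0\<close> itself.\<close>
  have f_rank_q: "fixrank f (q (Suc k)) = Suc n + card {i. i < k \<and> i div l \<in> D}" for k
  proof -
    have "{y. q 0 \<le> y \<and> y < q (Suc k) \<and> f y = y} =
        insert (q 0) ((\<lambda>i. q (Suc i)) ` {i. i < k \<and> i div l \<in> D})" (is "?A = ?B")
    proof (intro set_eqI iffI)
      fix y assume y: "y \<in> ?A"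
      show "y \<in> ?B"
      proof (cases "y = q 0")
        case False
        then obtain i where "y = q (Suc i)" "i div l \<in> D" using f_fix_ge[of y] y by auto
        then show ?thesis using y q_less by auto
      qed simp
    qed (use f_q0 f_fix_q q_less q_le in auto)
    moreover have "card ?B = Suc (card {i. i < k \<and> i div l \<in> D})"
    proof -
      have "inj_on (\<lambda>i. q (Suc i)) {i. i < k \<and> i div l \<in> D}" by (rule inj_onI) (simp add: q_eq)
      then show ?thesis by (subst card_insert_disjoint) (auto simp: card_image q_eq)
    qed
    ultimately show ?thesis
      using rank_split[of "q 0" "q (Suc k)" f] q_le f_rank_low[of "q 0"] q_rank[of 0] by simp
  qed
  have inf: "infinite (fixpoints f)"
  proof -
    have "infinite ((\<lambda>s. q (Suc (l * s))) ` D)"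
    proof (subst finite_image_iff)
      show "inj_on (\<lambda>s. q (Suc (l * s))) D" using l0 by (intro inj_onI) (simp add: q_eq)
      show "infinite D" using u_inf by (simp add: D_def)
    qed
    moreover have "(\<lambda>s. q (Suc (l * s))) ` D \<subseteq> fixpoints f"
    proof
      fix x assume "x \<in> (\<lambda>s. q (Suc (l * s))) ` D"
      then obtain s where s: "s \<in> D" "x = q (Suc (l * s))" by blast
      have "l * s div l \<in> D" using s(1) l0 by simp
      then show "x \<in> fixpoints f" using f_fix_q[of "l * s"] s(2) by (simp only: fixpoints_def mem_Collect_eq)
    qed
    ultimately show ?thesis by (blast dest: finite_subset)
  qed
  have part_fix: "part x = fixrank f x mod l" if x: "f x = x" for x
  proof (cases "x \<le> q 0")
    case True
    have "g x = x" using fixpoint_of_coarser[OF retr gD(1) fg] x by blast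
    then show ?thesis using gD(3) f_rank_low[OF True] by simp
  next
    case False
    then obtain k where k: "x = q (Suc k)" "k div l \<in> D" using f_fix_ge[of x] x by auto
    define j where "j = k mod l"
    have j: "j < l" "k = l * (k div l) + j" using l0 by (simp_all add: j_def)
    have "card {i. i < k \<and> i div l \<in> D} = card {i. i < l * (k div l) \<and> i div l \<in> D} + j"
      using dvd_card_blocks(2)[OF j(1) k(2)] j(2) by simp
    then have "fixrank f x = Suc n + (card {i. i < l * (k div l) \<and> i div l \<in> D} + j)"
      using f_rank_q k(1) by simp
    moreover obtain c where "card {i. i < l * (k div l) \<and> i div l \<in> D} = l * c"
      using dvd_card_blocks(1)[OF j(1), of "k div l" D] by (elim dvdE)
    ultimately have "fixrank f x mod l = (Suc n + j + l * c) mod l" by (simp add: ac_simps)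
    also have "\<dots> = (Suc n + j) mod l" by simp
    also have "\<dots> = (n + Suc k) mod l" using mod_add_right_eq[of "Suc n" k l] by (simp add: j_def)
    finally show ?thesis using q_part[of "Suc k"] k(1) by simp
  qed
  have adm: "admissible f"
    unfolding admissible_def using retr inf part_fix f_all by blast
  have f_min: "class_min n (fibre_rel f) = q 0"
    using class_min_iff[OF adm] f_q0 f_rank_low[of "q 0"] q_rank[of 0] by simp
  have approx_f: "approx n (fibre_rel f) = approx n (fibre_rel g)"
    unfolding approx_eq_iff[OF adm g]
  proof (intro conjI allI impI)
    show "class_min n (fibre_rel f) = class_min n (fibre_rel g)" using f_min by (simp add: q_def)
    fix x assume "x < class_min n (fibre_rel f)"
    then show "f x = g x" using f_low[of x] gD(5)[of x] f_min by simp
  qed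
  have "(approx (Suc n) (fibre_rel h) \<in> \<O>) = b"
    if h: "admissible h" and hf: "\<forall>x. h (f x) = h x" and ah: "approx n (fibre_rel h) = approx n (fibre_rel g)" for h
  proof -
    note hD = admissibleD[OF h]
    have h_min: "class_min n (fibre_rel h) = q 0" and h_low: "\<And>x. x < q 0 \<Longrightarrow> h x = g x"
      using ah approx_eq_iff[OF h g] by (auto simp: q_def)
    have h_q0: "h (q 0) = q 0" using class_min_fix[OF h, of n] h_min by simp
    have h_letter: "h z = z" if "g z = z" "z \<le> q 0" for z
      using that h_low[of z] h_q0 by (cases "z = q 0") auto
    have h_fix: "g z = z" if "h z = z" for z
      using fix_coarser[OF adm g] fix_coarser[OF h adm hf] fg that by blast
    define M where "M = class_min (Suc n) (fibre_rel h)"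
    have hM: "h M = M" using class_min_fix[OF h] by (simp add: M_def)
    have "q 0 < M" using class_min_less_iff[OF h, of n "Suc n"] h_min by (simp add: M_def)
    moreover have "f M = M" using fix_coarser[OF h adm hf hM] .
    ultimately obtain k where k: "M = q (Suc k)" "k div l \<in> D" using f_fix_ge[of M] by auto
    have "(n + Suc k) mod l = Suc n mod l"
      using part_class_min[OF h, of "Suc n"] q_part[of "Suc k"] k(1) by (simp add: M_def)
    then have "[Suc n + k = Suc n + 0] (mod l)" by (simp add: cong_def)
    \<comment> \<open>Condition (b) for \<open>h\<close> and for \<open>g\<close> gives
      \<open>M\<close> the same part, which forces \<open>M\<close> to the first position of its
      block; the blocks before it form a complete word.\<close>
    then have "[k = 0] (mod l)" by (simp only: cong_add_lcancel_nat)
    then have kl: "k mod l = 0" by (simp add: cong_def)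
    define s where "s = k div l"
    have k_eq: "k = l * s" using kl mult_div_mod_eq[of l k] by (simp add: s_def)
    have s: "u s = Inr s" using k(2) by (simp add: D_def s_def)
    have below_M: "z \<le> q 0" if "h z = z" "z < M" for z
    proof -
      have "class_min (fixrank h z) (fibre_rel h) < class_min (Suc n) (fibre_rel h)"
        using class_min_rank[OF h that(1)] that(2) by (simp add: M_def)
      then have "fixrank h z \<le> n" using class_min_less_iff[OF h] by simp
      then show ?thesis
        using class_min_le_iff[OF h, of "fixrank h z" n] class_min_rank[OF h that(1)] h_min by simp
    qed
    \<comment> \<open>The values of the variables are read off \<open>h\<close>, which sends every
      class before \<open>M\<close> to one of the old classes. From \<open>s\<close> on a default
      letter only keeps the values in the alphabet.\<close>
    define a where "a t = (if t < s then (\<lambda>j\<in>{..<l}. h (q (Suc (l * t + j)))) else (\<lambda>j\<in>{..<l}. 0))" for t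
    have a: "a t \<in> \<Lambda>" for t
    proof (cases "t < s")
      case True
      have "h (q (Suc (l * t + j))) \<in> {z. g z = z \<and> z \<le> q 0 \<and> part z \<le> (n + 1 + j) mod l}"
        if j: "j < l" for j
      proof -
        let ?z = "q (Suc (l * t + j))"
        have "l * t + j < l * Suc t" using j by simp
        also have "\<dots> \<le> l * s" using True by (intro mult_le_mono2) simp
        finally have "?z < M" using q_less k(1) k_eq by simp
        then have "h ?z < M" using hD(5)[of ?z] by simp
        then have "h ?z \<le> q 0" using below_M hD(6) by blast
        moreover have "g (h ?z) = h ?z" by (rule h_fix) (rule hD)
        moreover have "part ?z = (n + 1 + j) mod l"
        proof -
          have "(n + Suc (l * t + j)) mod l = (n + 1 + j + l * t) mod l" by (simp add: ac_simps)
          then show ?thesis using q_part by simp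
        qed
        ultimately show ?thesis using hD(4)[of ?z] by simp
      qed
      then show ?thesis using True unfolding a_def \<Lambda>_def by (auto simp: restrict_PiE_iff)
    next
      case False
      then show ?thesis using \<open>(\<lambda>j\<in>{..<l}. 0) \<in> \<Lambda>\<close> by (simp add: a_def)
    qed
    define W where "W = fill a (map u [0..<s])"
    have W_len: "length W = s" by (simp add: W_def fill_def)
    \<comment> \<open>As \<open>h\<close> is constant on the classes of \<open>f\<close>, its values
      below \<open>M\<close> are determined at old classes, which it fixes, and at blocks of
      variables, where \<open>a\<close> records them.\<close>
    have W_val: "ext (letter W) x = h x" if x: "x < M" for x
    proof -
      consider "g x \<le> q 0" | i where "g x = q (Suc i)" using cases_g by blast
      then show ?thesis
      proof cases
        case 1
        have "h x = h (f x)" using hf by simp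
        also have "\<dots> = g x" using f_low[OF 1] h_letter[of "g x"] gD(6) 1 by simp
        finally show ?thesis using 1 by (simp add: ext_def)
      next
        case 2
        have "q (Suc i) < M" using 2 gD(5)[of x] x by simp
        then have i: "i < l * s" using k(1) k_eq q_less by simp
        have i_div_less: "i div l < s" using i l0 by (simp add: less_mult_imp_div_less mult.commute)
        have ext: "ext (letter W) x = (W ! (i div l)) (i mod l)"
          using 2 q_less[of 0 "Suc i"] by (simp add: ext_def idx_q letter_def)
        have W_nth: "W ! (i div l) = (case u (i div l) of Inl c \<Rightarrow> c | Inr t \<Rightarrow> a t)"
          using i_div_less by (simp add: W_def fill_def split: sum.splits)
        have "h x = h (f x)" using hf by simp
        also have "f x = V (Suc i)" using fg[of x] f_q 2 by simp
        finally have hx: "h x = h (V (Suc i))" .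
        show ?thesis
        proof (cases "u (i div l)")
          case (Inl c)
          have "h (V (Suc i)) = V (Suc i)" using V_letter[OF Inl] h_letter by blast
          then show ?thesis using hx ext W_nth Inl V_letter[OF Inl] by simp
        next
          case (Inr t)
          then have "t < s" using u_var[OF Inr] i_div_less by simp
          then show ?thesis using hx ext W_nth Inr V_var[OF Inr] l0 by (simp add: a_def)
        qed
      qed
    qed
    have "approx (Suc n) (fibre_rel h) = wrel W"
    proof -
      have "q (1 + l * length W) = M" using W_len k(1) k_eq by simp
      then have "wrel W = {(x, y). x < M \<and> y < M \<and> ext (letter W) x = ext (letter W) y}"
        by (simp add: wrel_def Let_def)
      also have "\<dots> = {(x, y). x < M \<and> y < M \<and> h x = h y}" using W_val by auto
      also have "\<dots> = approx (Suc n) (fibre_rel h)"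
        by (auto simp: approx_def in_fibre_rel_iff M_def)
      finally show ?thesis by simp
    qed
    then show ?thesis using u_mono[OF s a] by (simp add: W_def)
  qed
  then show ?thesis using adm fg approx_f by blast
qed

lemma ellentuck_space_E_inf: "ellentuck_space (E_inf l P)"
proof
  fix A B n m assume "A \<in> E_inf l P" "B \<in> E_inf l P" "approx n A = approx m B"
  then show "n = m" using approx_eq_imp_eq by (metis E_infE)
next
  fix A B n k assume "A \<in> E_inf l P" "B \<in> E_inf l P" "approx n A = approx n B" "k \<le> n"
  then show "approx k A = approx k B" using approx_eq_mono by (metis E_infE)
next
  fix A B n assume "A \<in> E_inf l P" "B \<in> E_inf l P" "approx n A = approx n B"
  then show "class_min n A = class_min n B" using approx_eq_iff by (metis E_infE)
next
  fix A n m assume "A \<in> E_inf l P"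
  then show "class_min n A \<le> class_min m A \<longleftrightarrow> n \<le> m" using class_min_le_iff by (metis E_infE)
next
  fix A B n assume "A \<in> E_inf l P" "B \<in> E_inf l P" "coarser A B"
  then obtain f g where fg: "admissible f" "admissible g" "\<forall>x. f (g x) = f x" "A = fibre_rel f" "B = fibre_rel g"
    using coarser_iff by (metis E_infE)
  have "g (class_min n A) = class_min n A"
    using fix_coarser[OF fg(1-3)] class_min_fix[OF fg(1)] fg(4) by blast
  then show "\<exists>m. class_min n A = class_min m B" using class_min_rank[OF fg(2)] fg(5) by metis
next
  fix A B n m assume "A \<in> E_inf l P" "B \<in> E_inf l P" "coarser A B" "class_min n A = class_min m B"
  then obtain f g where fg: "admissible f" "admissible g" "\<forall>x. f (g x) = f x" "A = fibre_rel f" "B = fibre_rel g"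
    using coarser_iff by (metis E_infE)
  then show "\<exists>C\<in>E_inf l P. coarser C B \<and> approx m C = approx m B \<and>
      basic_set (E_inf l P) (approx n A) C \<subseteq> basic_set (E_inf l P) (approx n A) A"
    using fibre_rel_amalgamation[OF fg(1-3)] \<open>class_min n A = class_min m B\<close> by simp
next
  fix As :: "nat \<Rightarrow> nat rel" and n
  assume As: "\<And>i. As i \<in> E_inf l P" "\<And>i. coarser (As (Suc i)) (As i)"
    "\<And>i. approx (n + i) (As (Suc i)) = approx (n + i) (As i)"
  have "\<forall>i. \<exists>f. As i = fibre_rel f \<and> admissible f" using As(1) by (metis E_infE)
  then obtain f where f: "\<And>i. As i = fibre_rel (f i)" "\<And>i. admissible (f i)" by metis
  have "\<exists>g. admissible g \<and> (\<forall>i. (\<forall>x. g (f i x) = g x) \<and> approx (n + i) (fibre_rel g) = approx (n + i) (fibre_rel (f i)))"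
    by (rule fibre_rel_fusion_limit[OF f(2)]) (use As(2,3) f coarser_iff in auto)
  then obtain g where g: "admissible g" "\<And>i x. g (f i x) = g x"
      "\<And>i. approx (n + i) (fibre_rel g) = approx (n + i) (fibre_rel (f i))"
    by blast
  then show "\<exists>C\<in>E_inf l P. \<forall>i. coarser C (As i) \<and> approx (n + i) C = approx (n + i) (As i)"
    using f coarser_iff fibre_rel_in_E_inf by (intro bexI[of _ "fibre_rel g"]) auto
next
  fix B n \<O> assume "B \<in> E_inf l P"
  then obtain g where B: "B = fibre_rel g" and g: "admissible g" by (rule E_infE)
  obtain f b where f: "admissible f" "\<forall>x. f (g x) = f x" "approx n (fibre_rel f) = approx n (fibre_rel g)"
    and b: "\<And>h. admissible h \<Longrightarrow> \<forall>x. h (f x) = h x \<Longrightarrow> approx n (fibre_rel h) = approx n (fibre_rel g) \<Longrightarrow>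
       (approx (Suc n) (fibre_rel h) \<in> \<O>) = b"
    using fibre_rel_pigeonhole[OF g, of n \<O>] by blast
  have "fibre_rel f \<in> basic_set (E_inf l P) (approx n B) B"
    using f fibre_rel_in_E_inf coarser_iff[OF g] by (auto simp: basic_set_def B)
  moreover have "(approx (Suc n) C \<in> \<O>) = b" if C: "C \<in> basic_set (E_inf l P) (approx n B) (fibre_rel f)" for C
  proof -
    obtain h where h: "C = fibre_rel h" "admissible h" using C by (auto simp: basic_set_def elim: E_infE)
    obtain i where i: "approx i C = approx n B" and co: "coarser C (fibre_rel f)"
      using C by (auto simp: basic_set_def)
    have "i = n" using approx_eq_imp_eq[OF h(2) g] i h(1) B by simp
    then show ?thesis using b[OF h(2)] co coarser_iff[OF f(1)] i h(1) B by simp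
  qed
  ultimately show "\<exists>A\<in>basic_set (E_inf l P) (approx n B) B.
        (\<forall>C\<in>basic_set (E_inf l P) (approx n B) A. approx (Suc n) C \<in> \<O>) \<or>
        (\<forall>C\<in>basic_set (E_inf l P) (approx n B) A. approx (Suc n) C \<notin> \<O>)"
    by (intro bexI[of _ "fibre_rel f"]) (cases b; blast)+
qed

end

theorem theorem3p3:
  fixes l :: nat and P :: "nat \<Rightarrow> nat set"
  assumes "l \<ge> 1"
    and "(\<Union>i<l. P i) = UNIV"
    and "disjoint_family_on P {..<l}"
    and "\<forall>i<l. infinite (P i)"
    and "\<forall>i j. i < j \<and> j < l \<longrightarrow> (LEAST x. x \<in> P i) < (LEAST x. x \<in> P j)"
  shows "topological_ramsey_space (E_inf l P)"
proof -
  interpret typed_partition l P by unfold_locales (use assms in auto)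
  interpret ellentuck_space "E_inf l P" by (rule ellentuck_space_E_inf)
  show ?thesis by (rule topological_ramsey_space)
qed

end
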